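(* Let $\mathcal{G}$ be the random rooted tree, with root $\rho$, generated by a branching process in which the numbers of offspring of the individuals are i.i.d. non-negative integer-valued random variables with mean $m$, where $1<m<\infty$. Let $\lambda>0$ and let $\mathbf{X}=\{X_k, k\ge 0\}$ be the $\lambda$-biased random walk on $\mathcal{G}$ with $X_0=\rho$. Then $\mathbf{X}$ is (i) transient if $0<\lambda<m$, and (ii) positive recurrent if $\lambda>m$.
   Context: Tree: $\mathcal{G}$ is the genealogical (Galton–Watson) tree of a branching process started from a single individual $\rho$ (the root). For a vertex $\nu\ne\rho$, $\mathrm{par}(\nu)$ denotes its parent, i.e. the neighbor of $\nu$ on the path from $\nu$ to $\rho$; $\nu$ is a child of $\mathrm{par}(\nu)$. $\lambda$-biased random walk: conditionally on $\{\mathcal{G}=\Sigma\}$, for a rooted tree $\Sigma$, $\mathbf{X}$ is a Markov chain on the vertices of $\Sigma$ started at $\rho$ with the following transition probabilities. If $X_j=\nu\neq\rho$ and $\nu$ has $s\ge 0$ children, then $X_{j+1}=\mathrm{par}(\nu)$ with probability $\lambda/(\lambda+s)$, and $X_{j+1}$ equals any particular child of $\nu$ with probability $1/(\lambda+s)$. If $X_j=\rho$ and $\rho$ has $s\ge1$ children, then $X_{j+1}$ equals any particular child of $\rho$ with probability $1/s$; if $\rho$ has $s=0$ children, then $X_{j+1}=\rho$. Terminology: let $\tau:=\inf\{j\ge 1: X_j=\rho\}$. All probabilities and expectations are with respect to the joint law of the random tree and the walk. The process is transient if $\mathbf{P}(\tau=\infty)>0$, i.e. with positive probability it does not return to its starting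 point; it is recurrent if it is not transient; it is positive recurrent if it is recurrent and $\mathbf{E}[\tau]<\infty$. *)

theory Defs
  imports "HOL-Probability.Probability"
begin

(* Vertices carry Ulam-Harris labels: the root is [], and the i-th child of v (i = 0, 1, ...)
   is v @ [i]; hence the parent of v \<noteq> [] is butlast v. *)

inductive_set gw_tree :: "(nat list \<Rightarrow> nat) \<Rightarrow> nat list set"
  for N :: "nat list \<Rightarrow> nat" where
  root: "[] \<in> gw_tree N"
| child: "v \<in> gw_tree N \<Longrightarrow> i < N v \<Longrightarrow> v @ [i] \<in> gw_tree N"

definition children :: "nat list set \<Rightarrow> nat list \<Rightarrow> nat list set" where
  "children T v = {w \<in> T. \<exists>i. w = v @ [i]}"

definition parent :: "nat list \<Rightarrow> nat list" where
  "parent v = butlast v"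

(* Intended for locally finite trees; card is then the true number of children.
   Every gw_tree is locally finite. *)
definition trans_prob :: "real \<Rightarrow> nat list set \<Rightarrow> nat list \<Rightarrow> nat list \<Rightarrow> real" where
  "trans_prob lam T v w =
     (let s = card (children T v) in
      if v \<noteq> [] then
        (if w = parent v then lam / (lam + real s)
         else if w \<in> children T v then 1 / (lam + real s) else 0)
      else if s \<ge> 1 then
        (if w \<in> children T v then 1 / real s else 0)
      else
        (if w = v then 1 else 0))"

(* The sigma-algebra on the sample space generated by the random tree G. *)
definition tree_algebra :: "'w measure \<Rightarrow> ('w \<Rightarrow> nat list set) \<Rightarrow> 'w measure" where
  "tree_algebra M G = sigma (space M) (range (\<lambda>v. {\<omega> \<in> space M. v \<in> G \<omega>}))"

(* Conditionally on G, the process X is the Markov chain started at the root with the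
   transition probabilities above: its conditional finite-dimensional distributions given
   the sigma-algebra of G are those of this chain. *)
definition biased_walk ::
  "'w measure \<Rightarrow> real \<Rightarrow> ('w \<Rightarrow> nat list set) \<Rightarrow> (nat \<Rightarrow> 'w \<Rightarrow> nat list) \<Rightarrow> bool" where
  "biased_walk M lam G X \<longleftrightarrow>
     (\<forall>k. X k \<in> measurable M (count_space UNIV)) \<and>
     (\<forall>n x. AE \<omega> in M.
        real_cond_exp M (tree_algebra M G)
          (indicator {\<omega> \<in> space M. \<forall>k\<le>n. X k \<omega> = x k}) \<omega>
        = of_bool (x 0 = []) * (\<Prod>k<n. trans_prob lam (G \<omega>) (x k) (x (Suc k))))"

(* The infimum of the empty set in enat is \<infinity>. *)
definition return_time :: "(nat \<Rightarrow> 'w \<Rightarrow> nat list) \<Rightarrow> 'w \<Rightarrow> enat" where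
  "return_time X \<omega> = Inf {enat j | j. j \<ge> 1 \<and> X j \<omega> = []}"

definition transient :: "'w measure \<Rightarrow> (nat \<Rightarrow> 'w \<Rightarrow> nat list) \<Rightarrow> bool" where
  "transient M X \<longleftrightarrow> measure M {\<omega> \<in> space M. return_time X \<omega> = \<infinity>} > 0"

definition recurrent :: "'w measure \<Rightarrow> (nat \<Rightarrow> 'w \<Rightarrow> nat list) \<Rightarrow> bool" where
  "recurrent M X \<longleftrightarrow> \<not> transient M X"

definition positive_recurrent :: "'w measure \<Rightarrow> (nat \<Rightarrow> 'w \<Rightarrow> nat list) \<Rightarrow> bool" where
  "positive_recurrent M X \<longleftrightarrow>
     recurrent M X \<and> (\<integral>\<^sup>+ \<omega>. ennreal_of_enat (return_time X \<omega>) \<partial>M) < \<infinity>"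

end

theory Submission
  imports Defs
begin

text \<open>For \<open>m < lam\<close>, the expected number of visits to \<open>v\<close> before the return to the root is at most the
  reversible measure of \<open>v\<close> (normalised to 1 at the root), so the expected return time is at most its
  total mass. At depth \<open>n\<close> this mass has mean of order \<open>(m / lam)\<^sup>n\<close>, which is summable.

  For \<open>lam < m\<close>, truncate the offspring numbers at a level \<open>K\<close> for which their mean \<open>mu\<close> still exceeds
  \<open>max 1 lam\<close>, and let the branching martingale define a flow. Its second moments are bounded, hence so
  is its mean energy, because \<open>lam / mu < 1\<close>. By Thomson's principle the escape probability to depth
  \<open>n\<close> is at least \<open>W\<^sup>2 / Q \<ge> 2 t W - t\<^sup>2 Q\<close> for flow strength \<open>W\<close>, energy \<open>Q\<close> and any \<open>t\<close>; taking
  expectations, with \<open>W\<close> of mean 1, gives a positive bound independent of \<open>n\<close>.\<close>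

section \<open>The tree and the one-step probabilities\<close>

lemma gw_tree_snoc [simp]: "v @ [i] \<in> gw_tree b \<longleftrightarrow> v \<in> gw_tree b \<and> i < b v"
proof
  assume "v @ [i] \<in> gw_tree b"
  then show "v \<in> gw_tree b \<and> i < b v"
    by (cases rule: gw_tree.cases) auto
qed (auto intro: gw_tree.intros)

lemma gw_tree_Nil [simp]: "[] \<in> gw_tree b"
  by (rule gw_tree.root)

lemma mem_children_gw_tree:
  "w \<in> children (gw_tree b) v \<longleftrightarrow> v \<in> gw_tree b \<and> (\<exists>i<b v. w = v @ [i])"
  unfolding children_def by auto

lemma card_children_gw_tree:
  "card (children (gw_tree b) v) = (if v \<in> gw_tree b then b v else 0)"
proof -
  have "children (gw_tree b) v = (if v \<in> gw_tree b then (\<lambda>i. v @ [i]) ` {..<b v} else {})"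
    by (auto simp: mem_children_gw_tree)
  then show ?thesis
    by (simp add: card_image inj_on_def)
qed

abbreviation gw_trans :: "real \<Rightarrow> (nat list \<Rightarrow> nat) \<Rightarrow> nat list \<Rightarrow> nat list \<Rightarrow> real" where
  "gw_trans lam b \<equiv> trans_prob lam (gw_tree b)"

lemma trans_prob_nonneg: "0 \<le> lam \<Longrightarrow> 0 \<le> trans_prob lam T v w"
  by (auto simp: trans_prob_def Let_def)

lemma gw_trans_child:
  assumes "v \<in> gw_tree b" "i < b v"
  shows "gw_trans lam b v (v @ [i]) = (if v = [] then 1 / b v else 1 / (lam + b v))"
proof -
  have "v @ [i] \<noteq> butlast v"
    by (auto dest: arg_cong[where f=length])
  then show ?thesis
    using assms by (auto simp: trans_prob_def Let_def card_children_gw_tree mem_children_gw_tree parent_def)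
qed

lemma gw_trans_parent:
  assumes "p @ [i] \<in> gw_tree b"
  shows "gw_trans lam b (p @ [i]) p = lam / (lam + b (p @ [i]))"
  using assms by (simp add: trans_prob_def Let_def card_children_gw_tree parent_def)

text \<open>The assumption \<open>w \<noteq> []\<close> sets aside the self-loop of a childless
  root; every other step leads to the parent or to a child.\<close>

lemma gw_trans_eq_0:
  assumes "v \<in> gw_tree b" "w \<noteq> []" "w \<noteq> butlast v" "\<And>i. i < b v \<Longrightarrow> w \<noteq> v @ [i]"
  shows "gw_trans lam b v w = 0"
  using assms by (auto simp: trans_prob_def Let_def card_children_gw_tree mem_children_gw_tree parent_def)

section \<open>Avoiding the root\<close>

text \<open>\<open>avoid P n v\<close> is the probability that the chain from \<open>v\<close> avoids the root at the times \<open>1..n\<close>;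
  \<open>taboo P n v\<close> is the probability that the chain from the root does so and is at \<open>v\<close> at time \<open>n\<close>.\<close>

primrec avoid :: "(nat list \<Rightarrow> nat list \<Rightarrow> real) \<Rightarrow> nat \<Rightarrow> nat list \<Rightarrow> ennreal" where
  "avoid P 0 v = 1"
| "avoid P (Suc n) v = (\<integral>\<^sup>+w. ennreal (P v w) * avoid P n w \<partial>count_space (- {[]}))"

primrec taboo :: "(nat list \<Rightarrow> nat list \<Rightarrow> real) \<Rightarrow> nat \<Rightarrow> nat list \<Rightarrow> ennreal" where
  "taboo P 0 v = indicator {[]} v"
| "taboo P (Suc n) v =
     (if v = [] then 0 else (\<integral>\<^sup>+u. taboo P n u * ennreal (P u v) \<partial>count_space UNIV))"

text \<open>Both sides weigh the root-avoiding paths of \<open>k + n\<close> steps from the root,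
  cut at time \<open>k\<close>. Each induction step moves one transition from \<open>avoid\<close>
  to \<open>taboo\<close> by interchanging the two sums.\<close>

lemma nn_integral_taboo_avoid:
  "(\<integral>\<^sup>+v. taboo P k v * avoid P n v \<partial>count_space UNIV) = (\<integral>\<^sup>+v. taboo P (k + n) v \<partial>count_space UNIV)"
proof (induction n arbitrary: k)
  case (Suc n)
  have "(\<integral>\<^sup>+v. taboo P k v * avoid P (Suc n) v \<partial>count_space UNIV)
      = (\<integral>\<^sup>+v. \<integral>\<^sup>+w. taboo P k v * (ennreal (P v w) * avoid P n w) \<partial>count_space (- {[]}) \<partial>count_space UNIV)"
    by (simp add: nn_integral_cmult)
  also have "\<dots> = (\<integral>\<^sup>+w. \<integral>\<^sup>+v. taboo P k v * (ennreal (P v w) * avoid P n w) \<partial>count_space UNIV \<partial>count_space (- {[]}))"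
    by (rule nn_integral_count_space_nn_integral) auto
  also have "\<dots> = (\<integral>\<^sup>+w. taboo P (Suc k) w * avoid P n w \<partial>count_space (- {[]}))"
    by (intro nn_integral_cong) (simp add: nn_integral_multc mult.assoc[symmetric])
  \<comment> \<open>The root may be added to the range because \<open>taboo P (Suc k) []\<close> is
    0.\<close>
  also have "\<dots> = (\<integral>\<^sup>+w. taboo P (Suc k) w * avoid P n w \<partial>count_space UNIV)"
    by (rule nn_integral_count_space_eq) auto
  also have "\<dots> = (\<integral>\<^sup>+v. taboo P (k + Suc n) v \<partial>count_space UNIV)"
    using Suc[of "Suc k"] by simp
  finally show ?case .
qed simp

lemma avoid_Nil_eq_taboo: "avoid P n [] = (\<integral>\<^sup>+v. taboo P n v \<partial>count_space UNIV)"
proof -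
  have "(\<integral>\<^sup>+v. taboo P 0 v * avoid P n v \<partial>count_space UNIV) = (\<Sum>v\<in>{[]}. taboo P 0 v * avoid P n v)"
    by (rule nn_integral_count_space') auto
  then show ?thesis
    using nn_integral_taboo_avoid[of P 0 n] by simp
qed

text \<open>The expected numbers of visits before the return form the least measure that is
  excessive off the root and has mass at least 1 there. One application of \<open>P\<close> to the
  partial sum up to \<open>n\<close> gives its terms from 1 to \<open>n + 1\<close>.\<close>

lemma sum_taboo_le:
  assumes "1 \<le> g []" and sub: "\<And>v. v \<noteq> [] \<Longrightarrow> (\<integral>\<^sup>+u. g u * ennreal (P u v) \<partial>count_space UNIV) \<le> g v"
  shows "(\<Sum>k\<le>n. taboo P k v) \<le> g v"
proof (induction n arbitrary: v)
  case 0
  then show ?case using assms(1) by (auto simp: indicator_def)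
next
  case (Suc n)
  show ?case
  proof (cases "v = []")
    case True
    then show ?thesis
      using assms(1) by (simp add: sum.atMost_Suc_shift del: sum.atMost_Suc)
  next
    case False
    have "(\<Sum>k\<le>Suc n. taboo P k v) = (\<Sum>k\<le>n. taboo P (Suc k) v)"
      using False by (simp add: sum.atMost_Suc_shift del: sum.atMost_Suc taboo.simps(2))
    also have "\<dots> = (\<integral>\<^sup>+u. (\<Sum>k\<le>n. taboo P k u) * ennreal (P u v) \<partial>count_space UNIV)"
      using False by (simp add: sum_distrib_right nn_integral_sum)
    also have "\<dots> \<le> (\<integral>\<^sup>+u. g u * ennreal (P u v) \<partial>count_space UNIV)"
      by (intro nn_integral_mono mult_right_mono Suc) auto
    also have "\<dots> \<le> g v"
      by (rule sub[OF False])
    finally show ?thesis .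
  qed
qed

text \<open>The left side is the expected return time, written as the sum of its tail probabilities;
  it equals the total mass of the expected numbers of visits.\<close>

lemma suminf_avoid_le:
  assumes "1 \<le> g []" and "\<And>v. v \<noteq> [] \<Longrightarrow> (\<integral>\<^sup>+u. g u * ennreal (P u v) \<partial>count_space UNIV) \<le> g v"
  shows "(\<Sum>n. avoid P n []) \<le> (\<integral>\<^sup>+v. g v \<partial>count_space UNIV)"
proof (rule suminf_le_const)
  fix n
  have "(\<Sum>k<n. avoid P k []) \<le> (\<Sum>k\<le>n. avoid P k [])"
    by (intro sum_mono2) auto
  also have "\<dots> = (\<integral>\<^sup>+v. (\<Sum>k\<le>n. taboo P k v) \<partial>count_space UNIV)"
    by (simp add: avoid_Nil_eq_taboo nn_integral_sum)
  also have "\<dots> \<le> (\<integral>\<^sup>+v. g v \<partial>count_space UNIV)"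
    by (intro nn_integral_mono sum_taboo_le[OF assms])
  finally show "(\<Sum>k<n. avoid P k []) \<le> (\<integral>\<^sup>+v. g v \<partial>count_space UNIV)" .
qed (rule summableI)

section \<open>Expected return time on a fixed tree\<close>

text \<open>A reversible measure of the walk, except that the weights off the root should also carry the factor
  \<open>1 / b []\<close>; without it they can only increase, and their means are geometric in the depth.\<close>

definition stat :: "real \<Rightarrow> (nat list \<Rightarrow> nat) \<Rightarrow> nat list \<Rightarrow> real" where
  "stat lam b v =
     (if v = [] then 1
      else if v \<in> gw_tree b then (1 / lam) ^ (length v - 1) * (1 + b v / lam) else 0)"

lemma stat_nonneg: "0 < lam \<Longrightarrow> 0 \<le> stat lam b v"
  by (auto simp: stat_def)

text \<open>Mass balance: each child of \<open>v\<close> sends exactly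
  \<open>(1 / lam) ^ length v\<close> to \<open>v\<close>, and the parent at most
  \<open>(1 / lam) ^ (length v - 1)\<close>; these bounds add up to
  \<open>stat lam b v\<close>.\<close>

lemma stat_excessive:
  assumes lam: "0 < lam" and v: "v \<noteq> []"
  shows "(\<integral>\<^sup>+u. ennreal (stat lam b u) * ennreal (gw_trans lam b u v) \<partial>count_space UNIV) \<le> ennreal (stat lam b v)"
proof -
  obtain p i where v_eq: "v = p @ [i]"
    using v by (metis append_butlast_last_id)
  let ?f = "\<lambda>u. stat lam b u * gw_trans lam b u v"
  have le: "(\<integral>\<^sup>+u. ennreal (?f u) \<partial>count_space UNIV) \<le> ennreal (stat lam b v)"
  proof (cases "v \<in> gw_tree b")
    case False
    \<comment> \<open>Vertices off the tree carry no weight, and from a vertex of the tree the walk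
      cannot leave the tree.\<close>
    have zero: "?f u = 0" for u
    proof (cases "u \<in> gw_tree b")
      case True
      have "v \<noteq> butlast u"
        using True v False by (metis append_butlast_last_id butlast.simps(1) gw_tree_snoc)
      moreover have "v \<noteq> u @ [j]" if "j < b u" for j
        using True False that by auto
      ultimately show ?thesis
        using gw_trans_eq_0[OF True v] by simp
    qed (auto simp: stat_def)
    show ?thesis
      unfolding zero by simp
  next
    case True
    then have p: "p \<in> gw_tree b" "i < b p"
      by (auto simp: v_eq)
    let ?C = "(\<lambda>j. v @ [j]) ` {..<b v}"
    have "(\<integral>\<^sup>+u. ennreal (?f u) \<partial>count_space UNIV) = (\<Sum>u\<in>insert p ?C. ennreal (?f u))"
    proof (rule nn_integral_count_space')
      fix u assume u: "u \<notin> insert p ?C"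
      show "ennreal (?f u) = 0"
      proof (cases "u \<in> gw_tree b")
        case uT: True
        have "v \<noteq> butlast u"
        proof
          assume "v = butlast u"
          then have "u = v @ [last u]"
            using v by (metis append_butlast_last_id butlast.simps(1))
          then show False
            using u uT by (metis gw_tree_snoc imageI insertI2 lessThan_iff)
        qed
        moreover have "v \<noteq> u @ [j]" for j
          using u by (auto simp: v_eq)
        ultimately show ?thesis
          using gw_trans_eq_0[OF uT v] by simp
      next
        case False
        then show ?thesis
          by (metis ennreal_0 gw_tree_Nil mult_zero_left stat_def)
      qed
    qed auto
    also have "\<dots> = ennreal (\<Sum>u\<in>insert p ?C. ?f u)"
      using lam by (intro sum_ennreal mult_nonneg_nonneg stat_nonneg trans_prob_nonneg) auto
    also have "(\<Sum>u\<in>insert p ?C. ?f u) = ?f p + (\<Sum>j<b v. ?f (v @ [j]))"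
      by (subst sum.insert) (auto simp: v_eq sum.reindex inj_on_def)
    also have "(\<Sum>j<b v. ?f (v @ [j])) = (\<Sum>j<b v. (1 / lam) ^ length v)"
    proof (rule sum.cong)
      fix j assume j: "j \<in> {..<b v}"
      have "lam + real (b (v @ [j])) \<noteq> 0"
        using lam by (metis add_pos_nonneg less_irrefl of_nat_0_le_iff)
      moreover have "1 + b (v @ [j]) / lam = (lam + b (v @ [j])) / lam"
        using lam by (simp add: field_simps)
      ultimately show "?f (v @ [j]) = (1 / lam) ^ length v"
        using j True lam by (simp add: gw_trans_parent stat_def)
    qed simp
    \<comment> \<open>For a parent other than the root this is an equality; the root sends
      \<open>1 / b []\<close>, which is at most 1.\<close>
    also have "?f p \<le> (1 / lam) ^ length p"
    proof (cases "p = []")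
      case True
      then show ?thesis
        using p gw_trans_child[OF p, of lam] by (simp add: stat_def v_eq)
    next
      case False
      have "lam + real (b p) \<noteq> 0"
        using lam by (metis add_pos_nonneg less_irrefl of_nat_0_le_iff)
      moreover have "1 + b p / lam = (lam + b p) / lam"
        using lam by (simp add: field_simps)
      moreover have "(1 / lam) ^ length p = (1 / lam) ^ (length p - 1) * (1 / lam)"
        using False by (metis length_greater_0_conv power_minus_mult)
      ultimately show ?thesis
        using p gw_trans_child[OF p, of lam] False by (simp add: stat_def v_eq)
    qed
    also have "(1 / lam) ^ length p + (\<Sum>j<b v. (1 / lam) ^ length v) = stat lam b v"
      using True v by (simp add: stat_def v_eq add_divide_distrib distrib_left)
    finally show ?thesis
      by (simp add: ennreal_leI)
  qed
  then show ?thesis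
    using lam by (simp add: ennreal_mult' stat_nonneg)
qed

lemma suminf_avoid_gw_le:
  assumes "0 < lam"
  shows "(\<Sum>n. avoid (gw_trans lam b) n []) \<le> (\<integral>\<^sup>+v. ennreal (stat lam b v) \<partial>count_space UNIV)"
  by (rule suminf_avoid_le) (use assms stat_excessive in \<open>auto simp: stat_def\<close>)

section \<open>Escape probabilities on a fixed tree\<close>

text \<open>The escape probability to depth \<open>n\<close> below \<open>v\<close>, in the subtree in which each vertex keeps only
  its first \<open>K\<close> children: it is also the effective conductance from the parent of \<open>v\<close> to
  that depth, where the edge above \<open>v\<close> has conductance 1.\<close>

primrec esc :: "real \<Rightarrow> nat \<Rightarrow> nat \<Rightarrow> (nat list \<Rightarrow> nat) \<Rightarrow> nat list \<Rightarrow> real" where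
  "esc lam K 0 b v = 1"
| "esc lam K (Suc n) b v =
     (\<Sum>i<K. of_bool (i < b v) * esc lam K n b (v @ [i])) /
     (lam + (\<Sum>i<K. of_bool (i < b v) * esc lam K n b (v @ [i])))"

lemma esc_bounds:
  assumes "0 < lam"
  shows "0 \<le> esc lam K n b v \<and> esc lam K n b v \<le> 1"
proof (induction n arbitrary: v)
  case (Suc n)
  have "0 \<le> (\<Sum>i<K. of_bool (i < b v) * esc lam K n b (v @ [i]))"
    using Suc by (intro sum_nonneg) auto
  with assms show ?case by auto
qed simp

text \<open>One step of the chain, split into the moves to the children and to the parent. The bound
  \<open>r\<close> at the parent is 0 when the parent is the root, since that move ends the
  avoidance.\<close>

lemma avoid_ge_children:
  assumes lam: "0 < lam" and v: "v \<in> gw_tree b" and f: "\<And>i. i < b v \<Longrightarrow> 0 \<le> f i"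
    and av: "\<And>i. i < b v \<Longrightarrow> ennreal (f i) \<le> avoid (gw_trans lam b) n (v @ [i])"
    and r: "v \<noteq> [] \<Longrightarrow> butlast v \<noteq> [] \<Longrightarrow> ennreal r \<le> avoid (gw_trans lam b) n (butlast v)"
           "0 \<le> r" "v = [] \<or> butlast v = [] \<Longrightarrow> r = 0"
  shows "ennreal ((if v = [] then 0 else lam / (lam + b v) * r) +
      (\<Sum>i<b v. (if v = [] then 1 / b v else 1 / (lam + b v)) * f i))
    \<le> avoid (gw_trans lam b) (Suc n) v"
proof -
  let ?P = "gw_trans lam b"
  let ?C = "(\<lambda>i. v @ [i]) ` {..<b v}" and ?B = "if v = [] \<or> butlast v = [] then {} else {butlast v}"
  have disj: "?B \<inter> ?C = {}"
    by (auto dest: arg_cong[where f=length])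
  have nn: "0 \<le> ?P u w" for u w
    using lam by (intro trans_prob_nonneg) auto
  have "ennreal ((if v = [] then 0 else lam / (lam + b v) * r) +
      (\<Sum>i<b v. (if v = [] then 1 / b v else 1 / (lam + b v)) * f i))
    = ennreal ((\<Sum>w\<in>?B. ?P v w * r) + (\<Sum>i<b v. ?P v (v @ [i]) * f i))"
  proof -
    have "(if v = [] then 0 else lam / (lam + b v) * r) = (\<Sum>w\<in>?B. ?P v w * r)"
    proof (cases "v = []")
      case False
      then have "gw_trans lam b v (butlast v) = lam / (lam + b v)"
        using gw_trans_parent[of "butlast v" "last v" b lam] v by (metis append_butlast_last_id)
      then show ?thesis
        using r(3) by simp
    qed simp
    then show ?thesis
      using v by (simp add: gw_trans_child)
  qed
  also have "\<dots> = (\<Sum>w\<in>?B. ennreal (?P v w * r)) + (\<Sum>i<b v. ennreal (?P v (v @ [i]) * f i))"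
    using nn r(2) f
    by (subst ennreal_plus) (auto intro!: sum_nonneg mult_nonneg_nonneg sum_ennreal[symmetric])
  also have "\<dots> \<le> (\<Sum>w\<in>?B. ennreal (?P v w) * avoid ?P n w)
      + (\<Sum>i<b v. ennreal (?P v (v @ [i])) * avoid ?P n (v @ [i]))"
    using nn av r(1) by (intro add_mono sum_mono) (auto simp: ennreal_mult' intro!: mult_left_mono split: if_splits)
  also have "\<dots> = (\<Sum>w\<in>?B \<union> ?C. ennreal (?P v w) * avoid ?P n w)"
    using disj by (subst sum.union_disjoint) (auto simp: sum.reindex inj_on_def)
  also have "\<dots> = (\<integral>\<^sup>+w. ennreal (?P v w) * avoid ?P n w \<partial>count_space (?B \<union> ?C))"
    by (rule nn_integral_count_space_finite[symmetric]) auto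
  also have "\<dots> \<le> avoid ?P (Suc n) v"
    by (auto intro!: nn_integral_mono simp: nn_integral_count_space_indicator indicator_def)
  finally show ?thesis .
qed

text \<open>For \<open>v\<close> in the truncated tree, the factor at \<open>take j v\<close> is the
  probability of reaching its parent before level \<open>L\<close>, so the product is that of
  hitting the root before level \<open>L\<close>. One minus it is at most 1, vanishes at the root
  and is subharmonic for the full walk at levels 1 to \<open>L - 1\<close>, which allows induction
  on \<open>n\<close>.\<close>

lemma avoid_ge_prod:
  assumes lam: "0 < lam" and "v \<in> gw_tree b" "length v + n \<le> L"
  shows "ennreal (1 - (\<Prod>j\<in>{1..length v}. 1 - esc lam K (L - j) b (take j v))) \<le> avoid (gw_trans lam b) n v"
  using assms(2,3)
proof (induction n arbitrary: v)
  case 0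
  have "0 \<le> (\<Prod>j\<in>{1..length v}. 1 - esc lam K (L - j) b (take j v))"
    using esc_bounds[OF lam] by (intro prod_nonneg) auto
  then show ?case
    by (simp add: ennreal_le_1)
next
  case (Suc n)
  define F where "F w = (\<Prod>j\<in>{1..length w}. 1 - esc lam K (L - j) b (take j w))" for w
  have F01: "0 \<le> F w" "F w \<le> 1" for w
    using esc_bounds[OF lam] unfolding F_def by (auto intro!: prod_nonneg prod_le_1)
  have F_snoc: "F (w @ [i]) = F w * (1 - esc lam K (L - Suc (length w)) b (w @ [i]))" for w i
  proof -
    have "(\<Prod>j\<in>{1..length w}. 1 - esc lam K (L - j) b (take j (w @ [i]))) = F w"
      unfolding F_def by (rule prod.cong) auto
    then show ?thesis
      by (simp add: F_def)
  qed
  show ?case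
  proof (cases "v = []")
    case False
    then obtain u i where v_eq: "v = u @ [i]"
      by (metis append_butlast_last_id)
    have u: "u \<in> gw_tree b"
      using Suc.prems by (auto simp: v_eq)
    define S where "S = (\<Sum>i<K. of_bool (i < b v) * esc lam K (L - Suc (length v)) b (v @ [i]))"
    define S' where "S' = (\<Sum>i<b v. esc lam K (L - Suc (length v)) b (v @ [i]))"
    define a where "a = 1 - esc lam K (L - length v) b v"
    have "L - length v = Suc (L - Suc (length v))"
      using Suc.prems by simp
    then have a: "a = 1 - S / (lam + S)"
      by (simp add: a_def S_def)
    have "S = (\<Sum>i\<in>{..<K} \<inter> {i. i < b v}. esc lam K (L - Suc (length v)) b (v @ [i]))"
      by (simp add: S_def)
    also have "\<dots> \<le> S'"
      unfolding S'_def using esc_bounds[OF lam] by (intro sum_mono2) auto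
    finally have SS': "S \<le> S'" .
    have S0: "0 \<le> S"
      unfolding S_def using esc_bounds[OF lam] by (intro sum_nonneg) auto
    \<comment> \<open>With \<open>S\<close> in place of \<open>S'\<close> this is an equality;
      children beyond the first \<open>K\<close> only increase the sum.\<close>
    have aS: "lam \<le> a * (lam + S')"
    proof -
      have "a * (lam + S) = lam"
        using a S0 lam by (auto simp: field_simps)
      moreover have "0 \<le> a"
        using esc_bounds[OF lam] by (simp add: a_def)
      ultimately show ?thesis
        using SS' by (metis add_left_mono mult_left_mono)
    qed
    have "ennreal (lam / (lam + b v) * (1 - F u) + (\<Sum>i<b v. 1 / (lam + b v) * (1 - F (v @ [i]))))
        \<le> avoid (gw_trans lam b) (Suc n) v"
    proof -
      have "ennreal (1 - F (v @ [i])) \<le> avoid (gw_trans lam b) n (v @ [i])" if "i < b v" for i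
        using Suc.IH[of "v @ [i]"] Suc.prems that by (simp add: F_def)
      moreover have "ennreal (1 - F u) \<le> avoid (gw_trans lam b) n u"
        using Suc.IH[of u] Suc.prems u by (simp add: F_def v_eq)
      moreover have "F [] = 1"
        by (simp add: F_def)
      ultimately show ?thesis
        using avoid_ge_children[OF lam, of v b "\<lambda>i. 1 - F (v @ [i])" n "1 - F u"] Suc.prems F01
        by (simp add: v_eq)
    qed
    \<comment> \<open>Subharmonicity: after multiplication by \<open>lam + b v\<close> it reduces to
      \<open>aS\<close> multiplied by \<open>F u\<close>.\<close>
    moreover have "1 - F v \<le> lam / (lam + b v) * (1 - F u) + (\<Sum>i<b v. 1 / (lam + b v) * (1 - F (v @ [i])))"
    proof -
      have Fv: "F v = F u * a"
        unfolding v_eq F_snoc by (simp add: a_def v_eq)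
      have "(\<Sum>i<b v. F (v @ [i])) = F v * (b v - S')"
        unfolding F_snoc S'_def by (simp add: sum_distrib_left[symmetric] sum_subtractf)
      then have "lam / (lam + b v) * (1 - F u) + (\<Sum>i<b v. 1 / (lam + b v) * (1 - F (v @ [i])))
          = (lam * (1 - F u) + (b v - F v * (b v - S'))) / (lam + b v)"
        by (simp add: sum_divide_distrib[symmetric] sum_subtractf add_divide_distrib)
      moreover have "F u * lam \<le> F u * (a * (lam + S'))"
        using aS F01 by (intro mult_left_mono) auto
      then have "(1 - F v) * (lam + b v) \<le> lam * (1 - F u) + (b v - F v * (b v - S'))"
        unfolding Fv by (simp add: algebra_simps)
      ultimately show ?thesis
        using lam by (simp add: pos_le_divide_eq)
    qed
    ultimately show ?thesis
      unfolding F_def[symmetric] using ennreal_leI order_trans by blast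
  qed simp
qed

text \<open>Only a first step to the child \<open>[0]\<close> is counted. Its subtree does not
  contain the root, so the two factors on the left become independent for random offspring
  numbers.\<close>

lemma avoid_root_ge:
  assumes lam: "0 < lam"
  shows "ennreal (1 / b [] * esc lam K n b [0]) \<le> avoid (gw_trans lam b) (Suc n) []"
proof (cases "b [] = 0")
  case False
  let ?f = "\<lambda>i. if i = 0 then esc lam K n b [0] else 0"
  have "ennreal (?f i) \<le> avoid (gw_trans lam b) n ([] @ [i])" if "i < b []" for i
    using avoid_ge_prod[OF lam, of "[i]" b n "Suc n" K] that gw_tree_snoc[of "[]" i b] by (cases "i = 0") simp_all
  from avoid_ge_children[OF lam, of "[]" b ?f n 0, OF _ _ this] esc_bounds[OF lam]
  have "ennreal (\<Sum>i<b []. 1 / b [] * ?f i) \<le> avoid (gw_trans lam b) (Suc n) []"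
    by simp
  moreover have "(\<Sum>i<b []. 1 / b [] * ?f i) = 1 / b [] * esc lam K n b [0]"
    using False by (simp add: if_distrib[where f="\<lambda>x. _ * x"] sum.If_cases cong: if_cong)
  ultimately show ?thesis by metis
qed simp

text \<open>\<open>flow\<close> is the strength of the flow through the edge above \<open>v\<close> that splits according to the
  numbers of descendants, and \<open>energy\<close> is its energy below that edge.\<close>

primrec flow :: "real \<Rightarrow> nat \<Rightarrow> nat \<Rightarrow> (nat list \<Rightarrow> nat) \<Rightarrow> nat list \<Rightarrow> real" where
  "flow mu K 0 b v = 1"
| "flow mu K (Suc n) b v = (\<Sum>i<K. of_bool (i < b v) * flow mu K n b (v @ [i])) / mu"

primrec energy :: "real \<Rightarrow> real \<Rightarrow> nat \<Rightarrow> nat \<Rightarrow> (nat list \<Rightarrow> nat) \<Rightarrow> nat list \<Rightarrow> real" where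
  "energy lam mu K 0 b v = 1"
| "energy lam mu K (Suc n) b v = (flow mu K (Suc n) b v)\<^sup>2 +
     lam / mu\<^sup>2 * (\<Sum>i<K. of_bool (i < b v) * energy lam mu K n b (v @ [i]))"

text \<open>Truncation to \<open>K\<close> children bounds the flow at each depth, which yields
  integrability; estimates uniform in \<open>n\<close> come later from moments.\<close>

lemma flow_bounds:
  assumes "0 < mu"
  shows "0 \<le> flow mu K n b v \<and> flow mu K n b v \<le> (K / mu) ^ n"
proof (induction n arbitrary: v)
  case (Suc n)
  have "(\<Sum>i<K. of_bool (i < b v) * flow mu K n b (v @ [i])) \<le> (\<Sum>i<K. (K / mu) ^ n)"
    using Suc assms by (intro sum_mono) (auto simp: of_bool_def)
  moreover have "0 \<le> (\<Sum>i<K. of_bool (i < b v) * flow mu K n b (v @ [i]))"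
    using Suc by (intro sum_nonneg) auto
  ultimately show ?case
    using assms by (simp add: divide_simps)
qed simp

lemma energy_nonneg: "0 < lam \<Longrightarrow> 0 \<le> energy lam mu K n b v"
  by (induction n arbitrary: v) (auto intro!: add_nonneg_nonneg divide_nonneg_nonneg mult_nonneg_nonneg sum_nonneg)

lemma energy_bounded:
  assumes "0 < lam" "0 < mu"
  shows "\<exists>B. \<forall>b v. energy lam mu K n b v \<le> B"
proof (induction n)
  case (Suc n)
  then obtain B where B: "\<And>b v. energy lam mu K n b v \<le> B" by auto
  have B0: "0 \<le> B"
    using B energy_nonneg[OF assms(1)] order_trans by blast
  have "energy lam mu K (Suc n) b v \<le> ((K / mu) ^ Suc n)\<^sup>2 + lam / mu\<^sup>2 * (\<Sum>i<K. B)" for b v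
    unfolding energy.simps
  proof (intro add_mono mult_left_mono sum_mono power_mono)
    show "of_bool (i < b v) * energy lam mu K n b (v @ [i]) \<le> B" for i
      using B B0 by (auto simp: of_bool_def)
  qed (use flow_bounds[OF assms(2), of K "Suc n" b v] assms in \<open>auto simp del: flow.simps\<close>)
  then show ?case by blast
qed auto

text \<open>Thomson's principle: the effective conductance is at least (strength)\<open>\<^sup>2\<close> / energy.\<close>

lemma flow_sq_le:
  assumes lam: "0 < lam" and mu: "0 < mu"
  shows "(flow mu K n b v)\<^sup>2 \<le> esc lam K n b v * energy lam mu K n b v"
proof (induction n arbitrary: v)
  case (Suc n)
  define I where "I = {..<K} \<inter> {i. i < b v}"
  have I: "(\<Sum>i<K. of_bool (i < b v) * f i) = (\<Sum>i\<in>I. f i)" for f :: "nat \<Rightarrow> real"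
    by (simp add: I_def)
  define S where "S = (\<Sum>i\<in>I. esc lam K n b (v @ [i]))"
  define U where "U = (\<Sum>i\<in>I. energy lam mu K n b (v @ [i]))"
  define R where "R = (\<Sum>i\<in>I. flow mu K n b (v @ [i]))"
  note e = esc_bounds[OF lam, of K n b] and q = energy_nonneg[OF lam, of mu K n b]
  have S0: "0 \<le> S" and U0: "0 \<le> U"
    unfolding S_def U_def using e q by (auto intro: sum_nonneg)
  \<comment> \<open>By the induction hypothesis the flow into each child is at most a geometric
    mean, to which Cauchy-Schwarz applies.\<close>
  have "R \<le> (\<Sum>i\<in>I. sqrt (esc lam K n b (v @ [i])) * sqrt (energy lam mu K n b (v @ [i])))"
    unfolding R_def using Suc by (intro sum_mono) (simp add: real_le_rsqrt flip: real_sqrt_mult)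
  moreover have "0 \<le> R"
    unfolding R_def using flow_bounds[OF mu] by (intro sum_nonneg) auto
  ultimately have "R\<^sup>2 \<le> (\<Sum>i\<in>I. sqrt (esc lam K n b (v @ [i])) * sqrt (energy lam mu K n b (v @ [i])))\<^sup>2"
    by (rule power_mono)
  also have "\<dots> \<le> (\<Sum>i\<in>I. (sqrt (esc lam K n b (v @ [i])))\<^sup>2) * (\<Sum>i\<in>I. (sqrt (energy lam mu K n b (v @ [i])))\<^sup>2)"
    by (rule Cauchy_Schwarz_ineq_sum)
  also have "\<dots> = S * U"
    using e q by (simp add: S_def U_def)
  finally have RSU: "R\<^sup>2 \<le> S * U" .
  \<comment> \<open>Series law: joining the edge above \<open>v\<close> turns the conductance
    \<open>S / lam\<close> below \<open>v\<close> into \<open>S / (lam + S)\<close> and adds the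
    square of \<open>R / mu\<close> to the energy.\<close>
  have "(R / mu)\<^sup>2 * (lam + S) \<le> S * ((R / mu)\<^sup>2 + lam / mu\<^sup>2 * U)"
  proof -
    have "lam / mu\<^sup>2 * R\<^sup>2 \<le> lam / mu\<^sup>2 * (S * U)"
      using lam RSU by (intro mult_left_mono) auto
    then show ?thesis
      by (simp add: algebra_simps power_divide add_divide_distrib)
  qed
  then have "(R / mu)\<^sup>2 \<le> S / (lam + S) * ((R / mu)\<^sup>2 + lam / mu\<^sup>2 * U)"
    using lam S0 by (simp add: pos_le_divide_eq)
  then show ?case
    by (simp add: I S_def U_def R_def)
qed simp

text \<open>The quotient in Thomson's bound is replaced, by the inequality of arithmetic and
  geometric means, with a minorant linear in flow and energy, so that expectations can be taken term
  by term.\<close>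

lemma esc_ge:
  assumes "0 < lam" "0 < mu"
  shows "2 * t * flow mu K n b v - t\<^sup>2 * energy lam mu K n b v \<le> esc lam K n b v"
proof -
  let ?W = "flow mu K n b v" and ?Q = "energy lam mu K n b v" and ?g = "esc lam K n b v"
  have g: "0 \<le> ?g" and Q: "0 \<le> ?Q"
    using esc_bounds energy_nonneg assms by auto
  have "\<bar>t * ?W\<bar> \<le> sqrt (?g * (t\<^sup>2 * ?Q))"
    using mult_left_mono[OF flow_sq_le[OF assms, of K n b v], of "t\<^sup>2"]
    by (intro real_le_rsqrt) (simp add: power_mult_distrib algebra_simps)
  also have "\<dots> \<le> (?g + t\<^sup>2 * ?Q) / 2"
    using g Q by (intro arith_geo_mean_sqrt) auto
  finally show ?thesis by simp
qed

section \<open>The law of the walk\<close>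

text \<open>Countability of the index set gives joint measurability, after which the integral over
  one variable is measurable in the other.\<close>

lemma borel_measurable_nn_integral_count_space [measurable (raw)]:
  fixes f :: "'a \<Rightarrow> 'i \<Rightarrow> ennreal"
  assumes "countable A" and f: "\<And>i. i \<in> A \<Longrightarrow> (\<lambda>x. f x i) \<in> borel_measurable M"
  shows "(\<lambda>x. \<integral>\<^sup>+i. f x i \<partial>count_space A) \<in> borel_measurable M"
proof -
  have "(\<lambda>(i, x). f x i) \<in> borel_measurable (count_space A \<Otimes>\<^sub>M M)"
    using assms by (intro measurable_pair_measure_countable1) auto
  from measurable_compose[OF measurable_pair_swap' this]
  have "(\<lambda>(x, i). f x i) \<in> borel_measurable (M \<Otimes>\<^sub>M count_space A)"
    by (simp add: case_prod_beta')
  then show ?thesis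
    using sigma_finite_measure.borel_measurable_nn_integral
      [OF sigma_finite_measure_count_space_countable[OF \<open>countable A\<close>]] by blast
qed

section \<open>Measurability in the offspring numbers\<close>

abbreviation conf :: "(nat list \<Rightarrow> nat) measure" where
  "conf \<equiv> Pi\<^sub>M UNIV (\<lambda>_. count_space UNIV)"

lemma gw_tree_measurable [measurable]: "Measurable.pred conf (\<lambda>b. v \<in> gw_tree b)"
  by (induction v rule: rev_induct) simp_all

lemma gw_trans_measurable [measurable]: "(\<lambda>b. gw_trans lam b v w) \<in> borel_measurable conf"
  unfolding trans_prob_def Let_def card_children_gw_tree mem_children_gw_tree by measurable

lemma avoid_measurable [measurable]: "(\<lambda>b. avoid (gw_trans lam b) n v) \<in> borel_measurable conf"
  by (induction n arbitrary: v) (auto intro!: borel_measurable_nn_integral_count_space)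

locale random_env = prob_space M for M :: "'w measure" +
  fixes N :: "nat list \<Rightarrow> 'w \<Rightarrow> nat"
  assumes N_measurable [measurable]: "\<And>v. N v \<in> measurable M (count_space UNIV)"
begin

abbreviation env :: "'w \<Rightarrow> nat list \<Rightarrow> nat" where
  "env \<omega> \<equiv> \<lambda>v. N v \<omega>"

lemma env_measurable [measurable]: "env \<in> measurable M conf"
  by (rule measurable_PiM_single') auto

end

section \<open>Path probabilities of the walk on the random tree\<close>

locale random_walk_in_env = random_env M N for M :: "'w measure" and N +
  fixes X :: "nat \<Rightarrow> 'w \<Rightarrow> nat list" and lam :: real
  assumes lam: "0 < lam"
    and walk: "biased_walk M lam (\<lambda>\<omega>. gw_tree (env \<omega>)) X"
begin

lemma X_measurable [measurable]: "X k \<in> measurable M (count_space UNIV)"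
  using walk by (simp add: biased_walk_def)

abbreviation path_weight :: "nat \<Rightarrow> (nat \<Rightarrow> nat list) \<Rightarrow> 'w \<Rightarrow> real" where
  "path_weight n x \<omega> \<equiv> of_bool (x 0 = []) * (\<Prod>k<n. gw_trans lam (env \<omega>) (x k) (x (Suc k)))"

lemma path_weight_nonneg: "0 \<le> path_weight n x \<omega>"
  using lam by (intro mult_nonneg_nonneg prod_nonneg) (auto intro!: trans_prob_nonneg)

text \<open>Given the tree, the conditional probability of the path is almost surely its weight, and
  conditional expectation preserves the mean.\<close>

lemma emeasure_path:
  "emeasure M {\<omega> \<in> space M. \<forall>k\<le>n. X k \<omega> = x k} = (\<integral>\<^sup>+\<omega>. ennreal (path_weight n x \<omega>) \<partial>M)"
proof -
  let ?F = "tree_algebra M (\<lambda>\<omega>. gw_tree (env \<omega>))"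
  let ?A = "{\<omega> \<in> space M. \<forall>k\<le>n. X k \<omega> = x k}"
  have "subalgebra M ?F"
    unfolding subalgebra_def tree_algebra_def
    by (auto simp: sets_measure_of_conv intro!: sets.sigma_sets_subset split: if_splits)
  then interpret finite_measure_subalgebra M ?F
    by unfold_locales
  have A [measurable]: "?A \<in> sets M"
    by measurable
  have int: "integrable M (indicator ?A :: 'w \<Rightarrow> real)"
    by (simp add: integrable_indicator_iff less_top[symmetric])
  have eq: "AE \<omega> in M. real_cond_exp M ?F (indicator ?A) \<omega> = path_weight n x \<omega>"
    using walk unfolding biased_walk_def by blast
  have "integrable M (path_weight n x)"
    using real_cond_exp_int(1)[OF int] eq by (subst integrable_cong_AE[OF _ _ AE_symmetric[OF eq]]) auto
  then have "(\<integral>\<^sup>+\<omega>. ennreal (path_weight n x \<omega>) \<partial>M) = ennreal (\<integral>\<omega>. path_weight n x \<omega> \<partial>M)"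
    using path_weight_nonneg by (intro nn_integral_eq_integral) auto
  also have "(\<integral>\<omega>. path_weight n x \<omega> \<partial>M) = (\<integral>\<omega>. real_cond_exp M ?F (indicator ?A) \<omega> \<partial>M)"
    using eq by (intro integral_cong_AE) auto
  also have "\<dots> = measure M ?A"
    using real_cond_exp_int(2)[OF int] by simp
  finally show ?thesis
    by (simp add: emeasure_eq_measure)
qed

text \<open>Only the law of finite paths is given, so the avoidance is unrolled: the event is split
  by the vertex at time \<open>Suc k\<close>, and the induction hypothesis applies to the path
  lengthened by it.\<close>

lemma emeasure_path_avoid:
  "emeasure M {\<omega> \<in> space M. (\<forall>j\<le>k. X j \<omega> = x j) \<and> (\<forall>j\<in>{k<..k+n}. X j \<omega> \<noteq> [])}
    = (\<integral>\<^sup>+\<omega>. ennreal (path_weight k x \<omega>) * avoid (gw_trans lam (env \<omega>)) n (x k) \<partial>M)"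
proof (induction n arbitrary: k x)
  case 0
  then show ?case by (simp add: emeasure_path)
next
  case (Suc n)
  let ?E = "\<lambda>w. {\<omega> \<in> space M. (\<forall>j\<le>Suc k. X j \<omega> = (x(Suc k := w)) j) \<and>
    (\<forall>j\<in>{Suc k<..Suc k + n}. X j \<omega> \<noteq> [])}"
  have "{\<omega> \<in> space M. (\<forall>j\<le>k. X j \<omega> = x j) \<and> (\<forall>j\<in>{k<..k + Suc n}. X j \<omega> \<noteq> [])}
    = (\<Union>w\<in>- {[]}. ?E w)"
  proof -
    have "{k<..k + Suc n} = insert (Suc k) {Suc k<..Suc k + n}"
      by auto
    moreover have "(\<forall>j\<le>Suc k. X j \<omega> = (x(Suc k := w)) j) \<longleftrightarrow> (\<forall>j\<le>k. X j \<omega> = x j) \<and> X (Suc k) \<omega> = w" for \<omega> w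
      by (auto simp: le_Suc_eq)
    ultimately show ?thesis by auto
  qed
  then have "emeasure M {\<omega> \<in> space M. (\<forall>j\<le>k. X j \<omega> = x j) \<and> (\<forall>j\<in>{k<..k + Suc n}. X j \<omega> \<noteq> [])}
    = emeasure M (\<Union>w\<in>- {[]}. ?E w)"
    by simp
  also have "\<dots> = (\<integral>\<^sup>+w. emeasure M (?E w) \<partial>count_space (- {[]}))"
  proof (rule emeasure_UN_countable)
    show "disjoint_family_on ?E (- {[]})"
      by (auto simp: disjoint_family_on_def dest!: spec[of _ "Suc k"])
  qed auto
  also have "\<dots> = (\<integral>\<^sup>+w. \<integral>\<^sup>+\<omega>. ennreal (path_weight k x \<omega>) *
      (ennreal (gw_trans lam (env \<omega>) (x k) w) * avoid (gw_trans lam (env \<omega>)) n w) \<partial>M \<partial>count_space (- {[]}))"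
  proof (intro nn_integral_cong)
    fix w
    have "ennreal (path_weight (Suc k) (x(Suc k := w)) \<omega>)
        = ennreal (path_weight k x \<omega>) * ennreal (gw_trans lam (env \<omega>) (x k) w)" for \<omega>
      using path_weight_nonneg[of x \<omega> k] lam
      by (subst ennreal_mult'[symmetric]) (auto intro!: trans_prob_nonneg arg_cong[where f=ennreal])
    then show "emeasure M (?E w) = (\<integral>\<^sup>+\<omega>. ennreal (path_weight k x \<omega>) *
        (ennreal (gw_trans lam (env \<omega>) (x k) w) * avoid (gw_trans lam (env \<omega>)) n w) \<partial>M)"
      unfolding Suc.IH by (simp add: mult.assoc)
  qed
  also have "\<dots> = (\<integral>\<^sup>+\<omega>. \<integral>\<^sup>+w. ennreal (path_weight k x \<omega>) *
      (ennreal (gw_trans lam (env \<omega>) (x k) w) * avoid (gw_trans lam (env \<omega>)) n w) \<partial>count_space (- {[]}) \<partial>M)"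
    by (rule nn_integral_count_space_nn_integral[symmetric]) auto
  also have "\<dots> = (\<integral>\<^sup>+\<omega>. ennreal (path_weight k x \<omega>) * avoid (gw_trans lam (env \<omega>)) (Suc n) (x k) \<partial>M)"
    by (simp add: nn_integral_cmult)
  finally show ?case .
qed

lemma AE_start: "AE \<omega> in M. X 0 \<omega> = []"
proof -
  have "emeasure M {\<omega> \<in> space M. X 0 \<omega> = []} = 1"
    using emeasure_path[of 0 "\<lambda>_. []"] emeasure_space_1 by simp
  then show ?thesis
    by (subst AE_iff_emeasure_eq_1) (auto simp: emeasure_eq_measure)
qed

lemma emeasure_avoid:
  "emeasure M {\<omega> \<in> space M. \<forall>j\<in>{1..n}. X j \<omega> \<noteq> []} = (\<integral>\<^sup>+\<omega>. avoid (gw_trans lam (env \<omega>)) n [] \<partial>M)"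
proof -
  have "emeasure M {\<omega> \<in> space M. \<forall>j\<in>{1..n}. X j \<omega> \<noteq> []}
      = emeasure M {\<omega> \<in> space M. X 0 \<omega> = [] \<and> (\<forall>j\<in>{0<..n}. X j \<omega> \<noteq> [])}"
    using AE_start by (intro emeasure_eq_AE) (auto elim!: eventually_mono)
  then show ?thesis
    using emeasure_path_avoid[of 0 "\<lambda>_. []" n] by simp
qed

section \<open>The law of the return time\<close>

lemma return_time_gt_iff: "enat n < return_time X \<omega> \<longleftrightarrow> (\<forall>j\<in>{1..n}. X j \<omega> \<noteq> [])"
proof
  assume "\<forall>j\<in>{1..n}. X j \<omega> \<noteq> []"
  then have "enat (Suc n) \<le> return_time X \<omega>"
    unfolding return_time_def by (intro Inf_greatest) (force simp: not_less_eq_eq)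
  then show "enat n < return_time X \<omega>"
    by (simp add: Suc_ile_eq)
next
  assume n: "enat n < return_time X \<omega>"
  show "\<forall>j\<in>{1..n}. X j \<omega> \<noteq> []"
  proof
    fix j assume j: "j \<in> {1..n}"
    show "X j \<omega> \<noteq> []"
    proof
      assume "X j \<omega> = []"
      then have "return_time X \<omega> \<le> enat j"
        unfolding return_time_def using j by (intro Inf_lower) auto
      with n have "enat n < enat j"
        by (rule less_le_trans)
      with j show False by simp
    qed
  qed
qed

lemma return_time_measurable [measurable]: "return_time X \<in> measurable M (count_space UNIV)"
proof -
  have [measurable]: "Measurable.pred M (\<lambda>\<omega>. enat n < return_time X \<omega>)" for n
    unfolding return_time_gt_iff by measurable
  have "{\<omega> \<in> space M. return_time X \<omega> = t} \<in> sets M" for t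
  proof (cases t)
    case (enat n)
    have "s = enat n \<longleftrightarrow> (\<forall>k<n. enat k < s) \<and> \<not> enat n < s" for s
      by (cases s) (auto, metis less_irrefl linorder_neqE_nat)
    then have "{\<omega> \<in> space M. return_time X \<omega> = t} =
        {\<omega> \<in> space M. (\<forall>k<n. enat k < return_time X \<omega>) \<and> \<not> enat n < return_time X \<omega>}"
      by (simp add: enat)
    then show ?thesis by simp
  next
    case infinity
    have "s = \<infinity> \<longleftrightarrow> (\<forall>n. enat n < s)" for s
      by (cases s) auto
    then have "{\<omega> \<in> space M. return_time X \<omega> = t} = {\<omega> \<in> space M. \<forall>n. enat n < return_time X \<omega>}"
      by (simp add: infinity)
    then show ?thesis by simp
  qed
  then show ?thesis
    by (auto simp: measurable_count_space_eq2_countable vimage_def Int_def conj_commute)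
qed

lemma emeasure_return_time_gt:
  "emeasure M {\<omega> \<in> space M. enat n < return_time X \<omega>} = (\<integral>\<^sup>+\<omega>. avoid (gw_trans lam (env \<omega>)) n [] \<partial>M)"
  unfolding return_time_gt_iff by (rule emeasure_avoid)

text \<open>Tail-sum formula for the mean of an \<open>enat\<close>-valued variable, followed by the
  interchange of sum and expectation.\<close>

lemma nn_integral_return_time:
  "(\<integral>\<^sup>+\<omega>. ennreal_of_enat (return_time X \<omega>) \<partial>M)
    = (\<integral>\<^sup>+\<omega>. (\<Sum>n. avoid (gw_trans lam (env \<omega>)) n []) \<partial>M)"
  by (simp add: nn_integral_enat_function emeasure_return_time_gt nn_integral_suminf)

text \<open>Continuity from above along the events that no return occurs up to time
  \<open>n\<close>. The shift to \<open>Suc n\<close> leaves the limit unchanged and fits the form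
  of \<open>avoid_root_ge\<close>.\<close>

lemma emeasure_no_return_ge:
  assumes "\<And>n. c \<le> (\<integral>\<^sup>+\<omega>. avoid (gw_trans lam (env \<omega>)) (Suc n) [] \<partial>M)"
  shows "c \<le> emeasure M {\<omega> \<in> space M. return_time X \<omega> = \<infinity>}"
proof -
  let ?A = "\<lambda>n. {\<omega> \<in> space M. enat n < return_time X \<omega>}"
  have "{\<omega> \<in> space M. return_time X \<omega> = \<infinity>} = (\<Inter>n. ?A n)"
  proof -
    have "t = \<infinity> \<longleftrightarrow> (\<forall>n. enat n < t)" for t
      by (cases t) auto
    then show ?thesis by auto
  qed
  moreover have "(\<lambda>n. emeasure M (?A n)) \<longlonglongrightarrow> emeasure M (\<Inter>n. ?A n)"
    by (rule Lim_emeasure_decseq) (auto simp: decseq_def elim: le_less_trans[rotated])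
  then have "(\<lambda>n. emeasure M (?A (Suc n))) \<longlonglongrightarrow> emeasure M (\<Inter>n. ?A n)"
    by (rule LIMSEQ_Suc)
  ultimately show ?thesis
    using assms by (intro LIMSEQ_le_const) (auto simp: emeasure_return_time_gt simp del: avoid.simps)
qed

end

section \<open>Independent offspring numbers\<close>

text \<open>Such an \<open>f\<close> factors through the restriction to \<open>A\<close>; if
  measurable, functions of disjoint sets of labels are then independent for independent offspring
  numbers.\<close>

definition depends_on :: "nat list set \<Rightarrow> ((nat list \<Rightarrow> nat) \<Rightarrow> 'a) \<Rightarrow> bool" where
  "depends_on A f \<longleftrightarrow> (\<forall>b b'. (\<forall>v\<in>A. b v = b' v) \<longrightarrow> f b = f b')"

lemma depends_onD: "depends_on A f \<Longrightarrow> (\<And>v. v \<in> A \<Longrightarrow> b v = b' v) \<Longrightarrow> f b = f b'"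
  unfolding depends_on_def by blast

lemma depends_on_compose: "depends_on A f \<Longrightarrow> depends_on A (\<lambda>b. h (f b))"
  unfolding depends_on_def by metis

lemma depends_on_coord: "depends_on {v} (\<lambda>b. h (b v))"
  by (simp add: depends_on_def)

text \<open>Membership is decided by the strict ancestors of \<open>v\<close>. The set of all
  shorter labels is larger but still excludes \<open>v\<close>.\<close>

lemma depends_on_gw_tree: "depends_on {w. length w < length v} (\<lambda>b. v \<in> gw_tree b)"
  unfolding depends_on_def
proof (induction v rule: rev_induct)
  case (snoc i v)
  show ?case
  proof (intro allI impI)
    fix b b' :: "nat list \<Rightarrow> nat" assume eq: "\<forall>w\<in>{w. length w < length (v @ [i])}. b w = b' w"
    then have "v \<in> gw_tree b \<longleftrightarrow> v \<in> gw_tree b'"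
      by (intro snoc[rule_format]) auto
    then show "v @ [i] \<in> gw_tree b \<longleftrightarrow> v @ [i] \<in> gw_tree b'"
      using eq by auto
  qed
qed simp

abbreviation below :: "nat list \<Rightarrow> nat list set" where
  "below v \<equiv> range ((@) v)"

lemma below_snoc_subset: "below (v @ [i]) \<subseteq> below v"
  by auto

lemma depends_on_flow: "depends_on (below v) (\<lambda>b. flow mu K n b v)"
  unfolding depends_on_def
proof (induction n arbitrary: v)
  case (Suc n)
  show ?case
  proof (intro allI impI)
    fix b b' :: "nat list \<Rightarrow> nat" assume eq: "\<forall>u\<in>below v. b u = b' u"
    then have "b v = b' v"
      by (metis append_Nil2 rangeI)
    moreover have "flow mu K n b (v @ [i]) = flow mu K n b' (v @ [i])" for i
      using eq below_snoc_subset by (intro Suc[rule_format]) blast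
    ultimately show "flow mu K (Suc n) b v = flow mu K (Suc n) b' v"
      by simp
  qed
qed simp

lemma depends_on_energy: "depends_on (below v) (\<lambda>b. energy lam mu K n b v)"
  unfolding depends_on_def
proof (induction n arbitrary: v)
  case (Suc n)
  show ?case
  proof (intro allI impI)
    fix b b' :: "nat list \<Rightarrow> nat" assume eq: "\<forall>u\<in>below v. b u = b' u"
    then have "b v = b' v"
      by (metis append_Nil2 rangeI)
    moreover have "energy lam mu K n b (v @ [i]) = energy lam mu K n b' (v @ [i])" for i
      using eq below_snoc_subset by (intro Suc[rule_format]) blast
    moreover have "flow mu K (Suc n) b v = flow mu K (Suc n) b' v"
      using eq by (intro depends_onD[OF depends_on_flow]) blast
    ultimately show "energy lam mu K (Suc n) b v = energy lam mu K (Suc n) b' v"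
      by (simp del: flow.simps)
  qed
qed simp

lemma depends_on_esc: "depends_on (below v) (\<lambda>b. esc lam K n b v)"
  unfolding depends_on_def
proof (induction n arbitrary: v)
  case (Suc n)
  show ?case
  proof (intro allI impI)
    fix b b' :: "nat list \<Rightarrow> nat" assume eq: "\<forall>u\<in>below v. b u = b' u"
    then have "b v = b' v"
      by (metis append_Nil2 rangeI)
    moreover have "esc lam K n b (v @ [i]) = esc lam K n b' (v @ [i])" for i
      using eq below_snoc_subset by (intro Suc[rule_format]) blast
    ultimately show "esc lam K (Suc n) b v = esc lam K (Suc n) b' v"
      by simp
  qed
qed simp

lemma flow_measurable [measurable]: "(\<lambda>b. flow mu K n b v) \<in> borel_measurable conf"
  by (induction n arbitrary: v) simp_all

lemma energy_measurable [measurable]: "(\<lambda>b. energy lam mu K n b v) \<in> borel_measurable conf"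
  by (induction n arbitrary: v) (simp_all del: flow.simps)

lemma esc_measurable [measurable]: "(\<lambda>b. esc lam K n b v) \<in> borel_measurable conf"
  by (induction n arbitrary: v) simp_all

text \<open>A restricted configuration is constantly \<open>undefined\<close> off \<open>A\<close>,
  hence a full configuration with constant coordinates there. A measurable function on
  \<open>conf\<close> can thus be applied to it.\<close>

lemma restricted_conf_measurable:
  "(\<lambda>x. x) \<in> measurable (Pi\<^sub>M A (\<lambda>_. count_space UNIV)) conf"
proof (rule measurable_PiM_single')
  fix v :: "nat list"
  show "(\<lambda>x. x v) \<in> measurable (Pi\<^sub>M A (\<lambda>_. count_space UNIV)) (count_space (UNIV :: nat set))"
  proof (cases "v \<in> A")
    case False
    then have "x v = undefined" if "x \<in> space (Pi\<^sub>M A (\<lambda>_. count_space (UNIV :: nat set)))" for x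
      using that by (simp add: space_PiM PiE_def extensional_def)
    then have "(\<lambda>x. x v) \<in> measurable (Pi\<^sub>M A (\<lambda>_. count_space UNIV)) (count_space (UNIV :: nat set)) \<longleftrightarrow>
      (\<lambda>x. undefined) \<in> measurable (Pi\<^sub>M A (\<lambda>_. count_space (UNIV :: nat set))) (count_space (UNIV :: nat set))"
      by (rule measurable_cong)
    then show ?thesis by simp
  qed simp
qed auto

locale iid_env = prob_space M for M :: "'w measure" +
  fixes N :: "nat list \<Rightarrow> 'w \<Rightarrow> nat" and p :: "nat pmf" and m :: real
  assumes indep: "indep_vars (\<lambda>_. count_space UNIV) N UNIV"
    and ident: "\<And>v. distr M (count_space UNIV) (N v) = measure_pmf p"
    and mean_integrable: "integrable (measure_pmf p) real"
    and mean: "measure_pmf.expectation p real = m"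

sublocale iid_env \<subseteq> random_env
  using indep by unfold_locales (auto simp: indep_vars_def)

context iid_env
begin

text \<open>The restrictions of the environment to disjoint sets of labels are independent, and by
  \<open>depends_on\<close> restricting does not change the values of \<open>f\<close> and
  \<open>g\<close>.\<close>

lemma indep_var_env:
  assumes "f \<in> borel_measurable conf" "depends_on A f" "g \<in> borel_measurable conf" "depends_on B g"
    and "A \<inter> B = {}"
  shows "indep_var borel (\<lambda>\<omega>. f (env \<omega>)) borel (\<lambda>\<omega>. g (env \<omega>))"
proof -
  have "indep_var borel (f \<circ> (\<lambda>\<omega>. restrict (env \<omega>) A)) borel (g \<circ> (\<lambda>\<omega>. restrict (env \<omega>) B))"
    using assms
    by (intro indep_var_compose[OF indep_var_restrict[OF indep]])
       (auto intro: measurable_compose[OF restricted_conf_measurable])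
  moreover have "f (restrict (env \<omega>) A) = f (env \<omega>)" "g (restrict (env \<omega>) B) = g (env \<omega>)" for \<omega>
    using assms by (auto intro: depends_onD)
  ultimately show ?thesis
    by (simp add: comp_def)
qed

lemma
  fixes f g :: "(nat list \<Rightarrow> nat) \<Rightarrow> real"
  assumes "f \<in> borel_measurable conf" "depends_on A f" "g \<in> borel_measurable conf" "depends_on B g"
    and "A \<inter> B = {}" and "integrable M (\<lambda>\<omega>. f (env \<omega>))" "integrable M (\<lambda>\<omega>. g (env \<omega>))"
  shows expectation_mult: "expectation (\<lambda>\<omega>. f (env \<omega>) * g (env \<omega>))
      = expectation (\<lambda>\<omega>. f (env \<omega>)) * expectation (\<lambda>\<omega>. g (env \<omega>))"
    and integrable_mult: "integrable M (\<lambda>\<omega>. f (env \<omega>) * g (env \<omega>))"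
  using indep_var_lebesgue_integral indep_var_integrable indep_var_env[OF assms(1-5)] assms(6,7)
  by blast+

lemma integrable_bounded:
  assumes "f \<in> borel_measurable conf" "\<And>b. \<bar>f b\<bar> \<le> (B :: real)"
  shows "integrable M (\<lambda>\<omega>. f (env \<omega>))"
  using assms by (intro integrable_const_bound[where B=B]) (auto intro: measurable_compose[OF env_measurable])

text \<open>The probability that a given vertex of the tree has a child number \<open>i\<close>,
  counted from 0.\<close>

definition tail :: "nat \<Rightarrow> real" where
  "tail i = measure_pmf.prob p {i<..}"

lemma expectation_tail: "expectation (\<lambda>\<omega>. of_bool (i < N v \<omega>)) = tail i"
proof -
  have "expectation (\<lambda>\<omega>. of_bool (i < N v \<omega>)) = measure_pmf.expectation p (\<lambda>k. of_bool (i < k) :: real)"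
    unfolding ident[of v, symmetric] by (rule integral_distr[symmetric]) auto
  also have "\<dots> = measure_pmf.expectation p (indicator {i<..})"
    by (rule Bochner_Integration.integral_cong) (auto simp: indicator_def)
  finally show ?thesis
    by (simp add: tail_def)
qed

lemma integrable_offspring: "integrable M (\<lambda>\<omega>. real (N v \<omega>))"
  using mean_integrable by (subst (asm) ident[of v, symmetric], subst (asm) integrable_distr_eq) auto

lemma expectation_offspring: "expectation (\<lambda>\<omega>. real (N v \<omega>)) = m"
  using mean by (subst (asm) ident[of v, symmetric], subst (asm) integral_distr) auto

lemma suminf_tail: "(\<Sum>i. ennreal (tail i)) = ennreal m"
proof -
  have "(\<Sum>i. ennreal (tail i)) = (\<Sum>i. emeasure (measure_pmf p) {k \<in> space (measure_pmf p). i < k})"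
    by (intro suminf_cong) (simp add: tail_def measure_pmf.emeasure_eq_measure greaterThan_def)
  also have "\<dots> = (\<integral>\<^sup>+k. of_nat k \<partial>measure_pmf p)"
    by (rule nn_integral_nat_function[symmetric]) simp
  also have "\<dots> = (\<integral>\<^sup>+k. ennreal (real k) \<partial>measure_pmf p)"
    by (simp add: ennreal_of_nat_eq_real_of_nat)
  also have "\<dots> = ennreal m"
    using mean mean_integrable by (subst nn_integral_eq_integral) auto
  finally show ?thesis .
qed

section \<open>Biases above the mean\<close>

definition tprob :: "nat list \<Rightarrow> real" where
  "tprob v = expectation (\<lambda>\<omega>. of_bool (v \<in> gw_tree (env \<omega>)))"

text \<open>Whether \<open>v\<close> belongs to the tree is decided by labels shorter than
  \<open>v\<close>, hence is independent of \<open>N v\<close>.\<close>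

lemma expectation_in_tree_mult:
  assumes "integrable M (\<lambda>\<omega>. h (N v \<omega>) :: real)"
  shows "expectation (\<lambda>\<omega>. of_bool (v \<in> gw_tree (env \<omega>)) * h (N v \<omega>))
      = tprob v * expectation (\<lambda>\<omega>. h (N v \<omega>))" (is ?eq)
    and "integrable M (\<lambda>\<omega>. of_bool (v \<in> gw_tree (env \<omega>)) * h (N v \<omega>))" (is ?int)
proof -
  have *: "depends_on {w. length w < length v} (\<lambda>b. of_bool (v \<in> gw_tree b) :: real)"
    by (rule depends_on_compose[OF depends_on_gw_tree])
  have **: "integrable M (\<lambda>\<omega>. of_bool (v \<in> gw_tree (env \<omega>)) :: real)"
    by (rule integrable_bounded[where B=1]) auto
  show ?eq ?int
    using expectation_mult[OF _ * _ depends_on_coord _ ** assms]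
      integrable_mult[OF _ * _ depends_on_coord _ ** assms]
    by (auto simp: tprob_def)
qed

lemma tprob_snoc: "tprob (v @ [i]) = tprob v * tail i"
proof -
  have "integrable M (\<lambda>\<omega>. of_bool (i < N v \<omega>) :: real)"
    by (rule integrable_bounded[where B=1]) auto
  from expectation_in_tree_mult(1)[OF this] show ?thesis
    by (simp add: tprob_def[of "v @ [i]"] expectation_tail of_bool_conj)
qed

lemma tprob_nonneg: "0 \<le> tprob v"
  by (simp add: tprob_def)

text \<open>This is the mean size of generation \<open>n\<close>. Splitting off the last entry of a
  label turns the sum over the next generation into a double sum, whose inner sum of tails is the
  factor \<open>m\<close>.\<close>

lemma nn_integral_tprob_length:
  assumes "0 \<le> m"
  shows "(\<integral>\<^sup>+v. ennreal (tprob v) \<partial>count_space {v. length v = n}) = ennreal (m ^ n)"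
proof (induction n)
  case 0
  have "{v :: nat list. length v = 0} = {[]}"
    by auto
  moreover have "tprob [] = 1"
    by (simp add: tprob_def prob_space)
  ultimately show ?case
    by (simp add: nn_integral_count_space_finite)
next
  case (Suc n)
  let ?A = "{v :: nat list. length v = n}"
  interpret S: sigma_finite_measure "count_space (UNIV :: nat set)"
    by (rule sigma_finite_measure_count_space_countable) simp
  have bij: "bij_betw (\<lambda>(v, i). v @ [i]) (?A \<times> (UNIV :: nat set)) {v. length v = Suc n}"
    unfolding bij_betw_def inj_on_def by (auto simp: image_iff length_Suc_conv_rev)
  have "(\<integral>\<^sup>+v. ennreal (tprob v) \<partial>count_space {v. length v = Suc n})
      = (\<integral>\<^sup>+x. ennreal (tprob (case x of (v, i) \<Rightarrow> v @ [i])) \<partial>count_space (?A \<times> UNIV))"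
    by (rule nn_integral_bij_count_space[OF bij, symmetric])
  also have "\<dots> = (\<integral>\<^sup>+v. \<integral>\<^sup>+i. ennreal (tprob (v @ [i])) \<partial>count_space UNIV \<partial>count_space ?A)"
    using S.nn_integral_fst[where f="\<lambda>x. ennreal (tprob (case x of (v, i) \<Rightarrow> v @ [i]))"
        and ?M1.0="count_space ?A", symmetric]
    by (simp add: pair_measure_countable)
  also have "\<dots> = (\<integral>\<^sup>+v. ennreal (tprob v) * ennreal m \<partial>count_space ?A)"
    by (simp add: tprob_snoc ennreal_mult' tprob_nonneg nn_integral_cmult nn_integral_count_space_nat suminf_tail)
  also have "\<dots> = ennreal (m ^ Suc n)"
    using assms by (subst nn_integral_multc) (simp_all add: Suc ennreal_mult' mult.commute)
  finally show ?case .
qed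

text \<open>Off the root the mean is exact with the factor \<open>lam + m\<close>; the additional 1
  covers the root, where \<open>stat\<close> is 1.\<close>

lemma nn_integral_stat:
  assumes lam: "0 < lam" and m: "0 \<le> m"
  shows "(\<integral>\<^sup>+\<omega>. ennreal (stat lam (env \<omega>) v) \<partial>M)
    \<le> ennreal (1 + lam + m) * (ennreal ((1 / lam) ^ length v) * ennreal (tprob v))"
proof (cases "v = []")
  case True
  then show ?thesis
    using assms ennreal_leI[of 1 "1 + lam + m"]
    by (simp add: stat_def tprob_def prob_space emeasure_space_1 del: ennreal_plus)
next
  case False
  have int: "integrable M (\<lambda>\<omega>. 1 + N v \<omega> / lam)"
    using integrable_offspring[of v] by simp
  have e: "expectation (\<lambda>\<omega>. 1 + N v \<omega> / lam) = 1 + m / lam"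
    using integrable_offspring[of v] expectation_offspring[of v] by (simp add: prob_space)
  note tm = expectation_in_tree_mult[OF int]
  let ?c = "(1 / lam) ^ (length v - 1)"
  have stat: "stat lam (env \<omega>) v = ?c * (of_bool (v \<in> gw_tree (env \<omega>)) * (1 + N v \<omega> / lam))" for \<omega>
    using False by (simp add: stat_def)
  have "(\<integral>\<^sup>+\<omega>. ennreal (stat lam (env \<omega>) v) \<partial>M) = ennreal (expectation (\<lambda>\<omega>. stat lam (env \<omega>) v))"
    unfolding stat using tm(2) lam by (intro nn_integral_eq_integral) auto
  also have "expectation (\<lambda>\<omega>. stat lam (env \<omega>) v) = ?c * (tprob v * (1 + m / lam))"
    unfolding stat using tm by (simp add: e)
  also have "\<dots> = (lam + m) * ((1 / lam) ^ length v * tprob v)"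
  proof -
    have "(1 / lam) ^ length v = ?c * (1 / lam)"
      using False by (metis length_greater_0_conv power_minus_mult)
    moreover have "1 + m / lam = (lam + m) * (1 / lam)"
      using lam by (simp add: field_simps)
    ultimately show ?thesis
      by (simp only: ac_simps)
  qed
  also have "\<dots> \<le> (1 + lam + m) * ((1 / lam) ^ length v * tprob v)"
    using lam tprob_nonneg by (intro mult_right_mono) auto
  finally show ?thesis
    using lam m tprob_nonneg by (simp add: ennreal_mult ennreal_leI)
qed

text \<open>By Tonelli the mean mass is summed generation by generation, which leaves a geometric
  series of ratio \<open>m / lam\<close>.\<close>

lemma nn_integral_total_stat_finite:
  assumes lam: "0 < lam" and m: "0 \<le> m" "m < lam"
  shows "(\<integral>\<^sup>+\<omega>. \<integral>\<^sup>+v. ennreal (stat lam (env \<omega>) v) \<partial>count_space UNIV \<partial>M) < \<infinity>"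
proof -
  have [measurable]: "(\<lambda>\<omega>. stat lam (env \<omega>) v) \<in> borel_measurable M" for v
    unfolding stat_def by measurable
  have "(\<integral>\<^sup>+\<omega>. \<integral>\<^sup>+v. ennreal (stat lam (env \<omega>) v) \<partial>count_space UNIV \<partial>M)
      = (\<integral>\<^sup>+v. \<integral>\<^sup>+\<omega>. ennreal (stat lam (env \<omega>) v) \<partial>M \<partial>count_space UNIV)"
    by (rule nn_integral_count_space_nn_integral) auto
  also have "\<dots> \<le> (\<integral>\<^sup>+v. ennreal (1 + lam + m) * (ennreal ((1 / lam) ^ length v) * ennreal (tprob v)) \<partial>count_space UNIV)"
    by (intro nn_integral_mono nn_integral_stat lam m)
  also have "\<dots> = ennreal (1 + lam + m) * (\<integral>\<^sup>+v. ennreal ((1 / lam) ^ length v) * ennreal (tprob v) \<partial>count_space UNIV)"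
    by (simp add: nn_integral_cmult)
  also have "(\<integral>\<^sup>+v. ennreal ((1 / lam) ^ length v) * ennreal (tprob v) \<partial>count_space UNIV)
      = (\<integral>\<^sup>+v. (\<Sum>n. ennreal ((1 / lam) ^ n) * ennreal (tprob v) * indicator {v. length v = n} v) \<partial>count_space UNIV)"
  proof (intro nn_integral_cong)
    fix v :: "nat list"
    have "(\<Sum>n. ennreal ((1 / lam) ^ n) * ennreal (tprob v) * indicator {v. length v = n} v)
      = (\<Sum>n\<in>{length v}. ennreal ((1 / lam) ^ n) * ennreal (tprob v) * indicator {v. length v = n} v)"
      by (rule suminf_finite) auto
    then show "ennreal ((1 / lam) ^ length v) * ennreal (tprob v)
        = (\<Sum>n. ennreal ((1 / lam) ^ n) * ennreal (tprob v) * indicator {v. length v = n} v)"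
      by simp
  qed
  also have "\<dots> = (\<Sum>n. \<integral>\<^sup>+v. ennreal ((1 / lam) ^ n) * ennreal (tprob v) * indicator {v. length v = n} v \<partial>count_space UNIV)"
    by (rule nn_integral_suminf) simp
  also have "\<dots> = (\<Sum>n. ennreal ((1 / lam) ^ n) * ennreal (m ^ n))"
    by (simp add: mult.assoc nn_integral_cmult nn_integral_tprob_length[OF m(1)] flip: nn_integral_count_space_indicator)
  also have "\<dots> = (\<Sum>n. ennreal ((m / lam) ^ n))"
    using lam m by (intro suminf_cong, subst ennreal_mult[symmetric]) (auto simp: power_divide)
  also have "\<dots> = ennreal (\<Sum>n. (m / lam) ^ n)"
    using lam m by (intro suminf_ennreal2) (auto intro!: summable_geometric)
  finally show ?thesis
    by (rule le_less_trans) (simp add: ennreal_mult_less_top)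
qed

end

section \<open>Biases below the mean\<close>

text \<open>Sums over children keep a fixed index set with indicator factors, so that expectations
  pass through them term by term.\<close>

declare sum_of_bool_mult_eq [simp del] sum_mult_of_bool_eq [simp del]

text \<open>\<open>B / (1 - r)\<close> is the fixed point of the recursion; the summand 1 covers the
  initial value and is only shrunk by it.\<close>

lemma affine_recursion_bounded:
  fixes a :: "nat \<Rightarrow> real"
  assumes "a 0 \<le> 1" "\<And>n. a (Suc n) \<le> B + r * a n" "0 \<le> r" "r < 1" "0 \<le> B"
  shows "a n \<le> 1 + B / (1 - r)"
proof (induction n)
  case 0
  then show ?case using assms by (simp add: add_increasing2)
next
  case (Suc n)
  have "a (Suc n) \<le> B + r * (1 + B / (1 - r))"
    using assms(2)[of n] Suc assms(3) mult_left_mono by fastforce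
  also have "\<dots> = r + B / (1 - r)"
    using assms(4) by (simp add: field_simps)
  finally show ?case using assms(4) by simp
qed

text \<open>Indicators are kept on the diagonal, where they give the contraction of second moments,
  and dropped off it, so that the cross terms involve only disjoint subtrees.\<close>

lemma square_of_bool_sum_le:
  fixes f :: "nat \<Rightarrow> real"
  assumes "\<And>i. 0 \<le> f i"
  shows "(\<Sum>i<K. of_bool (P i) * f i)\<^sup>2
    \<le> (\<Sum>i<K. of_bool (P i) * (f i)\<^sup>2) + (\<Sum>i<K. \<Sum>j\<in>{..<K} - {i}. f i * f j)"
proof -
  have "(\<Sum>i<K. of_bool (P i) * f i)\<^sup>2 = (\<Sum>i<K. \<Sum>j<K. (of_bool (P i) * f i) * (of_bool (P j) * f j))"
    by (simp add: power2_eq_square sum_product)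
  also have "\<dots> = (\<Sum>i<K. of_bool (P i) * (f i)\<^sup>2
      + (\<Sum>j\<in>{..<K} - {i}. (of_bool (P i) * f i) * (of_bool (P j) * f j)))"
    by (intro sum.cong refl) (auto simp: sum.remove power2_eq_square of_bool_def)
  also have "\<dots> \<le> (\<Sum>i<K. of_bool (P i) * (f i)\<^sup>2 + (\<Sum>j\<in>{..<K} - {i}. f i * f j))"
    using assms by (intro sum_mono add_mono) (auto simp: of_bool_def)
  finally show ?thesis
    by (simp add: sum.distrib)
qed

context iid_env
begin

text \<open>The existence of child \<open>i\<close> depends on \<open>N v\<close> alone and
  \<open>f\<close> at that child only on labels below it, so the factors are independent.\<close>

lemma expectation_children:
  fixes f :: "nat list \<Rightarrow> (nat list \<Rightarrow> nat) \<Rightarrow> real"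
  assumes f: "\<And>v. f v \<in> borel_measurable conf" "\<And>v. depends_on (below v) (f v)"
    and int: "\<And>v. integrable M (\<lambda>\<omega>. f v (env \<omega>))"
  shows "expectation (\<lambda>\<omega>. \<Sum>i<K. of_bool (i < N v \<omega>) * f (v @ [i]) (env \<omega>))
      = (\<Sum>i<K. tail i * expectation (\<lambda>\<omega>. f (v @ [i]) (env \<omega>)))"
    and "integrable M (\<lambda>\<omega>. \<Sum>i<K. of_bool (i < N v \<omega>) * f (v @ [i]) (env \<omega>))"
proof -
  have disj: "{v} \<inter> below (v @ [i]) = {}" for i
    by auto
  have bool: "integrable M (\<lambda>\<omega>. of_bool (i < N v \<omega>) :: real)" for i
    by (rule integrable_bounded[where B=1]) auto
  note * = depends_on_coord[of v "\<lambda>k. of_bool (i < k) :: real" for i]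
  have i: "integrable M (\<lambda>\<omega>. of_bool (i < N v \<omega>) * f (v @ [i]) (env \<omega>))" for i
    by (rule integrable_mult[OF _ * f disj bool int]) simp
  have "expectation (\<lambda>\<omega>. of_bool (i < N v \<omega>) * f (v @ [i]) (env \<omega>))
      = tail i * expectation (\<lambda>\<omega>. f (v @ [i]) (env \<omega>))" for i
    using expectation_mult[OF _ * f disj bool int] by (simp add: expectation_tail)
  with i show "expectation (\<lambda>\<omega>. \<Sum>i<K. of_bool (i < N v \<omega>) * f (v @ [i]) (env \<omega>))
      = (\<Sum>i<K. tail i * expectation (\<lambda>\<omega>. f (v @ [i]) (env \<omega>)))"
    by simp
  show "integrable M (\<lambda>\<omega>. \<Sum>i<K. of_bool (i < N v \<omega>) * f (v @ [i]) (env \<omega>))"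
    using i by simp
qed

lemma tail_nonneg: "0 \<le> tail i"
  by (simp add: tail_def)

section \<open>Moment bounds when each vertex keeps its first \<open>K\<close> children\<close>

context
  fixes K :: nat and mu lam :: real
  assumes mu: "mu = (\<Sum>i<K. tail i)" and mu1: "1 < mu" and lam: "0 < lam" and lam_less: "lam < mu"
begin

lemma flow_sq_bounded: "\<bar>(flow mu K n b v)\<^sup>2\<bar> \<le> ((K / mu) ^ n)\<^sup>2"
  using flow_bounds[of mu K n b v] mu1 by (simp add: power_mono)

lemma integrable_flow: "integrable M (\<lambda>\<omega>. flow mu K n (env \<omega>) v)"
  using flow_bounds[of mu K n _ v] mu1 by (intro integrable_bounded[where B="(K / mu) ^ n"]) auto

lemma integrable_flow_sq: "integrable M (\<lambda>\<omega>. (flow mu K n (env \<omega>) v)\<^sup>2)"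
  by (rule integrable_bounded[OF _ flow_sq_bounded]) simp

lemma integrable_energy: "integrable M (\<lambda>\<omega>. energy lam mu K n (env \<omega>) v)"
proof -
  obtain B where "\<And>b v. energy lam mu K n b v \<le> B"
    using energy_bounded[of lam mu K n] lam mu1 by auto
  then show ?thesis
    using energy_nonneg[OF lam] by (intro integrable_bounded[where B=B]) auto
qed

lemma integrable_esc: "integrable M (\<lambda>\<omega>. esc lam K n (env \<omega>) v)"
  using esc_bounds[OF lam] by (intro integrable_bounded[where B=1]) auto

text \<open>\<open>mu\<close> is the mean number of retained children, so the division by
  \<open>mu\<close> in \<open>flow\<close> preserves the mean.\<close>

lemma expectation_flow: "expectation (\<lambda>\<omega>. flow mu K n (env \<omega>) v) = 1"
proof (induction n arbitrary: v)
  case (Suc n)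
  then show ?case
    using expectation_children(1)[of "\<lambda>v b. flow mu K n b v" v K] mu1
    by (simp add: depends_on_flow integrable_flow flip: mu)
qed (simp add: prob_space)

text \<open>After multiplication by \<open>mu\<^sup>2\<close>, the diagonal contributes at most
  \<open>mu\<close> times the previous bound. The cross terms contribute at most
  \<open>K\<^sup>2\<close>, since flows into distinct children are independent with mean 1. This
  gives a recursion with factor \<open>1 / mu\<close>.\<close>

lemma expectation_flow_sq_le: "expectation (\<lambda>\<omega>. (flow mu K n (env \<omega>) v)\<^sup>2) \<le> 1 + (K / mu)\<^sup>2 / (1 - 1 / mu)"
proof -
  have rec: "expectation (\<lambda>\<omega>. (flow mu K (Suc n) (env \<omega>) v)\<^sup>2) \<le> (K / mu)\<^sup>2 + 1 / mu * s"
    if s: "\<And>v. expectation (\<lambda>\<omega>. (flow mu K n (env \<omega>) v)\<^sup>2) \<le> s" for n v s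
  proof -
    let ?f = "\<lambda>i \<omega>. flow mu K n (env \<omega>) (v @ [i])"
    have prod: "expectation (\<lambda>\<omega>. ?f i \<omega> * ?f j \<omega>) = 1" "integrable M (\<lambda>\<omega>. ?f i \<omega> * ?f j \<omega>)"
      if "i \<noteq> j" for i j
    proof -
      have disj: "below (v @ [i]) \<inter> below (v @ [j]) = {}"
        using that by auto
      show "expectation (\<lambda>\<omega>. ?f i \<omega> * ?f j \<omega>) = 1"
        using expectation_mult[OF _ depends_on_flow _ depends_on_flow disj integrable_flow integrable_flow]
        by (simp add: expectation_flow)
      show "integrable M (\<lambda>\<omega>. ?f i \<omega> * ?f j \<omega>)"
        using integrable_mult[OF _ depends_on_flow _ depends_on_flow disj integrable_flow integrable_flow]
        by simp
    qed
    have sq: "depends_on (below w) (\<lambda>b. (flow mu K n b w)\<^sup>2)" for w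
      by (rule depends_on_compose[OF depends_on_flow])
    note ch = expectation_children[of "\<lambda>w b. (flow mu K n b w)\<^sup>2" v K, OF _ sq integrable_flow_sq, simplified]
    have int: "integrable M (\<lambda>\<omega>. \<Sum>i<K. \<Sum>j\<in>{..<K} - {i}. ?f i \<omega> * ?f j \<omega>)"
      using prod(2) by (intro Bochner_Integration.integrable_sum) auto
    have "mu\<^sup>2 * expectation (\<lambda>\<omega>. (flow mu K (Suc n) (env \<omega>) v)\<^sup>2)
        = expectation (\<lambda>\<omega>. mu\<^sup>2 * (flow mu K (Suc n) (env \<omega>) v)\<^sup>2)"
      by simp
    also have "\<dots> \<le> expectation (\<lambda>\<omega>. (\<Sum>i<K. of_bool (i < N v \<omega>) * (?f i \<omega>)\<^sup>2)
          + (\<Sum>i<K. \<Sum>j\<in>{..<K} - {i}. ?f i \<omega> * ?f j \<omega>))"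
    proof (rule integral_mono)
      show "integrable M (\<lambda>\<omega>. mu\<^sup>2 * (flow mu K (Suc n) (env \<omega>) v)\<^sup>2)"
        by (intro integrable_mult_right integrable_flow_sq)
      show "integrable M (\<lambda>\<omega>. (\<Sum>i<K. of_bool (i < N v \<omega>) * (?f i \<omega>)\<^sup>2)
          + (\<Sum>i<K. \<Sum>j\<in>{..<K} - {i}. ?f i \<omega> * ?f j \<omega>))"
        using ch(2) int by (intro Bochner_Integration.integrable_add) simp_all
      fix \<omega>
      have "mu\<^sup>2 * (flow mu K (Suc n) (env \<omega>) v)\<^sup>2 = (\<Sum>i<K. of_bool (i < N v \<omega>) * ?f i \<omega>)\<^sup>2"
        using mu1 by (simp add: power_divide)
      then show "mu\<^sup>2 * (flow mu K (Suc n) (env \<omega>) v)\<^sup>2 \<le> (\<Sum>i<K. of_bool (i < N v \<omega>) * (?f i \<omega>)\<^sup>2)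
          + (\<Sum>i<K. \<Sum>j\<in>{..<K} - {i}. ?f i \<omega> * ?f j \<omega>)"
        using square_of_bool_sum_le[of "\<lambda>i. ?f i \<omega>" "\<lambda>i. i < N v \<omega>" K] flow_bounds[of mu K n] mu1
        by simp
    qed
    also have "\<dots> = expectation (\<lambda>\<omega>. \<Sum>i<K. of_bool (i < N v \<omega>) * (?f i \<omega>)\<^sup>2)
          + expectation (\<lambda>\<omega>. \<Sum>i<K. \<Sum>j\<in>{..<K} - {i}. ?f i \<omega> * ?f j \<omega>)"
      using ch(2) int by (intro Bochner_Integration.integral_add) simp_all
    also have "expectation (\<lambda>\<omega>. \<Sum>i<K. of_bool (i < N v \<omega>) * (?f i \<omega>)\<^sup>2)
        = (\<Sum>i<K. tail i * expectation (\<lambda>\<omega>. (?f i \<omega>)\<^sup>2))"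
      using ch(1) by simp
    also have "\<dots> \<le> (\<Sum>i<K. tail i * s)"
      using s tail_nonneg by (intro sum_mono mult_left_mono)
    also have "\<dots> = mu * s"
      by (simp add: mu sum_distrib_right)
    also have "expectation (\<lambda>\<omega>. \<Sum>i<K. \<Sum>j\<in>{..<K} - {i}. ?f i \<omega> * ?f j \<omega>)
        = (\<Sum>i<K. expectation (\<lambda>\<omega>. \<Sum>j\<in>{..<K} - {i}. ?f i \<omega> * ?f j \<omega>))"
      using prod(2) by (intro Bochner_Integration.integral_sum Bochner_Integration.integrable_sum) auto
    also have "\<dots> = (\<Sum>i<K. \<Sum>j\<in>{..<K} - {i}. expectation (\<lambda>\<omega>. ?f i \<omega> * ?f j \<omega>))"
      using prod(2) by (intro sum.cong refl Bochner_Integration.integral_sum) auto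
    also have "\<dots> = (\<Sum>i<K. \<Sum>j\<in>{..<K} - {i}. 1)"
      by (intro sum.cong refl prod(1)) auto
    also have "\<dots> \<le> (\<Sum>i<K. real K)"
      by (intro sum_mono) (auto intro: order_trans[OF card_Diff1_le])
    finally have "mu\<^sup>2 * expectation (\<lambda>\<omega>. (flow mu K (Suc n) (env \<omega>) v)\<^sup>2) \<le> mu * s + (real K)\<^sup>2"
      by (simp add: power2_eq_square)
    then have "expectation (\<lambda>\<omega>. (flow mu K (Suc n) (env \<omega>) v)\<^sup>2) \<le> (mu * s + (real K)\<^sup>2) / mu\<^sup>2"
      using mu1 by (subst pos_le_divide_eq) (simp_all add: mult.commute del: flow.simps)
    also have "\<dots> = (K / mu)\<^sup>2 + 1 / mu * s"
      using mu1 by (simp add: power2_eq_square field_simps)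
    finally show ?thesis .
  qed
  \<comment> \<open>The iterates from 1 bound the second moments at all vertices
    simultaneously.\<close>
  define s where "s n = ((\<lambda>x. (K / mu)\<^sup>2 + 1 / mu * x) ^^ n) 1" for n
  have "expectation (\<lambda>\<omega>. (flow mu K n (env \<omega>) v)\<^sup>2) \<le> s n"
  proof (induction n arbitrary: v)
    case (Suc n)
    then show ?case
      using rec[of n "s n" v] by (simp add: s_def del: flow.simps)
  qed (simp add: s_def prob_space)
  also have "s n \<le> 1 + (K / mu)\<^sup>2 / (1 - 1 / mu)"
    using mu1 by (intro affine_recursion_bounded) (auto simp: s_def)
  finally show ?thesis .
qed

text \<open>On average \<open>mu\<close> children contribute with weight
  \<open>lam / mu\<^sup>2\<close> each, so the recursion has factor \<open>lam / mu\<close>; the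
  second moments of the flow supply its additive constant.\<close>

lemma expectation_energy_bounded: "\<exists>C>0. \<forall>n v. expectation (\<lambda>\<omega>. energy lam mu K n (env \<omega>) v) \<le> C"
proof -
  define B where "B = 1 + (K / mu)\<^sup>2 / (1 - 1 / mu)"
  have B: "0 \<le> B"
    using mu1 by (auto simp: B_def intro!: add_nonneg_nonneg divide_nonneg_nonneg)
  define e where "e n = ((\<lambda>x. B + lam / mu * x) ^^ n) 1" for n
  have "expectation (\<lambda>\<omega>. energy lam mu K n (env \<omega>) v) \<le> e n" for n v
  proof (induction n arbitrary: v)
    case (Suc n)
    note ch = expectation_children[of "\<lambda>v b. energy lam mu K n b v" v K, OF _ depends_on_energy integrable_energy, simplified]
    have "expectation (\<lambda>\<omega>. energy lam mu K (Suc n) (env \<omega>) v)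
        = expectation (\<lambda>\<omega>. (flow mu K (Suc n) (env \<omega>) v)\<^sup>2)
          + lam / mu\<^sup>2 * expectation (\<lambda>\<omega>. \<Sum>i<K. of_bool (i < N v \<omega>) * energy lam mu K n (env \<omega>) (v @ [i]))"
      unfolding energy.simps using ch(2)
      by (subst Bochner_Integration.integral_add)
        (simp_all only: integrable_flow_sq integrable_mult_right sum_of_bool_mult_eq integral_mult_right_zero finite_lessThan)
    also have "\<dots> \<le> B + lam / mu\<^sup>2 * (\<Sum>i<K. tail i * e n)"
    proof (intro add_mono mult_left_mono)
      show "expectation (\<lambda>\<omega>. (flow mu K (Suc n) (env \<omega>) v)\<^sup>2) \<le> B"
        unfolding B_def by (rule expectation_flow_sq_le)
      show "expectation (\<lambda>\<omega>. \<Sum>i<K. of_bool (i < N v \<omega>) * energy lam mu K n (env \<omega>) (v @ [i]))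
          \<le> (\<Sum>i<K. tail i * e n)"
        using ch(1) Suc tail_nonneg by (auto intro!: sum_mono mult_left_mono)
    qed (use lam in auto)
    also have "\<dots> = e (Suc n)"
      using mu1 by (simp add: e_def sum_distrib_right[symmetric] mu[symmetric] power2_eq_square)
    finally show ?case .
  qed (simp add: e_def prob_space)
  moreover have "e n \<le> 1 + B / (1 - lam / mu)" for n
    using mu1 lam lam_less B by (intro affine_recursion_bounded) (auto simp: e_def)
  moreover have "0 < 1 + B / (1 - lam / mu)"
    using mu1 lam_less B by (intro add_pos_nonneg divide_nonneg_nonneg) auto
  ultimately show ?thesis
    by (meson order_trans)
qed

lemma expectation_esc_ge: "\<exists>c>0. \<forall>n v. c \<le> expectation (\<lambda>\<omega>. esc lam K n (env \<omega>) v)"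
proof -
  obtain C where C: "0 < C" "\<And>n v. expectation (\<lambda>\<omega>. energy lam mu K n (env \<omega>) v) \<le> C"
    using expectation_energy_bounded by blast
  have "1 / C \<le> expectation (\<lambda>\<omega>. esc lam K n (env \<omega>) v)" for n v
  proof -
    \<comment> \<open>The choice \<open>t = 1 / C\<close> in \<open>esc_ge\<close> maximises
      \<open>2 * t - t\<^sup>2 * C\<close>.\<close>
    have "1 / C = 2 * (1 / C) - (1 / C)\<^sup>2 * C"
      using C(1) by (simp add: power2_eq_square)
    also have "\<dots> \<le> 2 * (1 / C) - (1 / C)\<^sup>2 * expectation (\<lambda>\<omega>. energy lam mu K n (env \<omega>) v)"
      using C by (intro diff_mono mult_left_mono) auto
    also have "\<dots> = expectation (\<lambda>\<omega>. 2 * (1 / C) * flow mu K n (env \<omega>) v - (1 / C)\<^sup>2 * energy lam mu K n (env \<omega>) v)"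
      using integrable_flow integrable_energy by (simp add: expectation_flow)
    also have "\<dots> \<le> expectation (\<lambda>\<omega>. esc lam K n (env \<omega>) v)"
      using lam mu1 integrable_flow integrable_energy integrable_esc by (intro integral_mono esc_ge) auto
    finally show ?thesis .
  qed
  with C(1) show ?thesis
    by (meson divide_pos_pos zero_less_one)
qed

end

lemma truncated_mean_gt:
  assumes "0 \<le> a" "a < m"
  shows "\<exists>K. a < (\<Sum>i<K. tail i)"
proof -
  have "(\<lambda>K. \<Sum>i<K. ennreal (tail i)) \<longlonglongrightarrow> ennreal m"
    using summable_LIMSEQ[of "\<lambda>i. ennreal (tail i)"] by (simp add: suminf_tail)
  moreover have "ennreal a < ennreal m"
    using assms by (simp add: ennreal_lessI)
  ultimately have "\<forall>\<^sub>F K in sequentially. ennreal a < (\<Sum>i<K. ennreal (tail i))"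
    by (rule order_tendstoD(1))
  then obtain K where "ennreal a < (\<Sum>i<K. ennreal (tail i))"
    using eventually_happens'[OF sequentially_bot] by blast
  then have "a < (\<Sum>i<K. tail i)"
    using assms tail_nonneg by (simp add: sum_ennreal ennreal_less_iff)
  then show ?thesis ..
qed

text \<open>Here \<open>1 / 0 = 0\<close>: a childless root does not contribute.\<close>

lemma expectation_inverse_offspring_pos:
  assumes "m \<noteq> 0"
  shows "0 < expectation (\<lambda>\<omega>. 1 / N v \<omega>)"
proof -
  have int: "integrable M (\<lambda>\<omega>. 1 / N v \<omega>)"
    by (rule integrable_bounded[of "\<lambda>b. 1 / b v" 1]) (auto simp: divide_simps)
  have "expectation (\<lambda>\<omega>. 1 / N v \<omega>) \<noteq> 0"
  proof
    assume "expectation (\<lambda>\<omega>. 1 / N v \<omega>) = 0"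
    then have "AE \<omega> in M. 1 / real (N v \<omega>) = 0"
      using integral_nonneg_eq_0_iff_AE[OF int] by simp
    \<comment> \<open>The reciprocal vanishes only at 0, so the offspring number would be 0 almost
      surely.\<close>
    then have "expectation (\<lambda>\<omega>. real (N v \<omega>)) = 0"
      by (intro integral_eq_zero_AE) (auto elim!: eventually_mono)
    with assms show False
      by (simp add: expectation_offspring)
  qed
  moreover have "0 \<le> expectation (\<lambda>\<omega>. 1 / N v \<omega>)"
    by (intro integral_nonneg_AE) auto
  ultimately show ?thesis by linarith
qed

text \<open>The bound at the root is a product of independent factors, so its mean factors too. The
  escape probability at \<open>[0]\<close> is defined even if that child is absent; the reciprocal
  of the root's offspring number is then 0.\<close>

lemma nn_integral_avoid_ge:
  assumes "1 < m" "0 < lam" "lam < m"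
  shows "\<exists>c>0. \<forall>n. ennreal c \<le> (\<integral>\<^sup>+\<omega>. avoid (gw_trans lam (env \<omega>)) (Suc n) [] \<partial>M)"
proof -
  \<comment> \<open>Exceeding 1 keeps the second moments of the flow bounded; exceeding
    \<open>lam\<close> keeps the mean energy bounded.\<close>
  obtain K where K: "max 1 lam < (\<Sum>i<K. tail i)"
    using truncated_mean_gt[of "max 1 lam"] assms by (auto simp: max.coboundedI1)
  obtain c where c: "0 < c" "\<And>n v. c \<le> expectation (\<lambda>\<omega>. esc lam K n (env \<omega>) v)"
    using expectation_esc_ge[OF refl _ assms(2)] K by force
  let ?d = "expectation (\<lambda>\<omega>. 1 / N [] \<omega>)"
  have d: "0 < ?d"
    using assms by (intro expectation_inverse_offspring_pos) simp
  have "ennreal (?d * c) \<le> (\<integral>\<^sup>+\<omega>. avoid (gw_trans lam (env \<omega>)) (Suc n) [] \<partial>M)" for n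
  proof -
    have disj: "{[]} \<inter> below [0] = {}"
      by auto
    have inv: "integrable M (\<lambda>\<omega>. 1 / real (N [] \<omega>))"
      by (rule integrable_bounded[of "\<lambda>b. 1 / b []" 1]) (auto simp: divide_simps)
    have esc: "integrable M (\<lambda>\<omega>. esc lam K n (env \<omega>) [0])"
      using esc_bounds[OF assms(2)] by (intro integrable_bounded[where B=1]) auto
    note coord = depends_on_coord[of "[]" "\<lambda>k. 1 / real k"]
    note int = integrable_mult[OF _ coord _ depends_on_esc disj inv esc]
    have "?d * c \<le> ?d * expectation (\<lambda>\<omega>. esc lam K n (env \<omega>) [0])"
      using c d by (intro mult_left_mono) auto
    also have "\<dots> = expectation (\<lambda>\<omega>. 1 / N [] \<omega> * esc lam K n (env \<omega>) [0])"
      using expectation_mult[OF _ coord _ depends_on_esc disj inv esc] by simp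
    finally have "ennreal (?d * c) \<le> ennreal (expectation (\<lambda>\<omega>. 1 / N [] \<omega> * esc lam K n (env \<omega>) [0]))"
      by (rule ennreal_leI)
    also have "\<dots> = (\<integral>\<^sup>+\<omega>. ennreal (1 / N [] \<omega> * esc lam K n (env \<omega>) [0]) \<partial>M)"
      using int esc_bounds[OF assms(2)] by (intro nn_integral_eq_integral[symmetric]) auto
    also have "\<dots> \<le> (\<integral>\<^sup>+\<omega>. avoid (gw_trans lam (env \<omega>)) (Suc n) [] \<partial>M)"
      by (intro nn_integral_mono avoid_root_ge assms)
    finally show ?thesis .
  qed
  with c d show ?thesis
    by (meson mult_pos_pos)
qed

end

theorem theorem1:
  fixes M :: "'w measure"
    and N :: "nat list \<Rightarrow> 'w \<Rightarrow> nat"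
    and X :: "nat \<Rightarrow> 'w \<Rightarrow> nat list"
    and p :: "nat pmf"
    and m lam :: real
  assumes "prob_space M"
    and indep: "prob_space.indep_vars M (\<lambda>_. count_space UNIV) N UNIV"
    and ident: "\<And>v. distr M (count_space UNIV) (N v) = measure_pmf p"
    and "integrable (measure_pmf p) real"
    and "measure_pmf.expectation p real = m"
    and "1 < m"
    and "0 < lam"
    and "biased_walk M lam (\<lambda>\<omega>. gw_tree (\<lambda>v. N v \<omega>)) X"
  shows "(lam < m \<longrightarrow> transient M X) \<and> (m < lam \<longrightarrow> positive_recurrent M X)"
proof -
  interpret prob_space M by fact
  interpret iid_env M N p m
    using assms by unfold_locales auto
  interpret random_walk_in_env M N X lam
    using assms by unfold_locales auto
  show ?thesis
  proof (intro conjI impI)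
    assume "lam < m"
    then obtain c where "0 < c" "\<And>n. ennreal c \<le> (\<integral>\<^sup>+\<omega>. avoid (gw_trans lam (env \<omega>)) (Suc n) [] \<partial>M)"
      using nn_integral_avoid_ge assms by blast
    then have "ennreal c \<le> emeasure M {\<omega> \<in> space M. return_time X \<omega> = \<infinity>}"
      by (intro emeasure_no_return_ge)
    with \<open>0 < c\<close> show "transient M X"
      unfolding transient_def emeasure_eq_measure by (simp add: ennreal_le_iff)
  next
    assume "m < lam"
    have "(\<integral>\<^sup>+\<omega>. ennreal_of_enat (return_time X \<omega>) \<partial>M)
        \<le> (\<integral>\<^sup>+\<omega>. \<integral>\<^sup>+v. ennreal (stat lam (env \<omega>) v) \<partial>count_space UNIV \<partial>M)"
      unfolding nn_integral_return_time by (intro nn_integral_mono suminf_avoid_gw_le assms)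
    also have "\<dots> < \<infinity>"
      using assms \<open>m < lam\<close> by (intro nn_integral_total_stat_finite) auto
    finally have fin: "(\<integral>\<^sup>+\<omega>. ennreal_of_enat (return_time X \<omega>) \<partial>M) < \<infinity>" .
    \<comment> \<open>A finite mean forces the return time to be finite almost surely, which gives
      recurrence.\<close>
    then have "AE \<omega> in M. ennreal_of_enat (return_time X \<omega>) \<noteq> \<infinity>"
      by (intro nn_integral_PInf_AE) auto
    then have "AE \<omega> in M. \<not> return_time X \<omega> = \<infinity>"
      by (elim eventually_mono) (metis ennreal_of_enat_infty infinity_ennreal_def)
    then have "measure M {\<omega> \<in> space M. return_time X \<omega> = \<infinity>} = 0"
      by (subst (asm) AE_iff_measurable[OF _ refl]) (auto simp: measure_def)
    with fin show "positive_recurrent M X"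
      by (simp add: positive_recurrent_def recurrent_def transient_def)
  qed
qed

end
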